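(* Let $n\geq 2$, let $\mathbb{K}$ be a field of characteristic different from $2$, and let $m\geq 1$. An $m$-fold extension $f\colon\mathscr{B}\to\mathscr{A}$ in the category of Leibniz $n$-algebras over $\mathbb{K}$ is central with respect to the subvariety of Lie $n$-algebras if and only if the object $$\sum_{I_{1}\cup\dots\cup I_{n}=\langle m\rangle}\Bigl\langle\bigcap_{i\in I_{1}}K[f_{i}],\dots,\bigcap_{i\in I_{n}}K[f_{i}]\Bigr\rangle$$ is zero.
   Context: A Leibniz $n$-algebra over $\mathbb{K}$ is a $\mathbb{K}$-vector space $\mathscr{L}$ with an $n$-linear operation $[-,\dots,-]\colon\mathscr{L}^n\to\mathscr{L}$ satisfying $$[[l_{1},\dots,l_{n}],l'_{1},\dots,l'_{n-1}]=\sum_{1\leq i\leq n}[l_{1},\dots,l_{i-1},[l_{i},l'_{1},\dots,l'_{n-1}],l_{i+1},\dots,l_{n}].$$ It is a Lie $n$-algebra if moreover $[l_1,\dots,l_n]=\mathrm{sgn}(\sigma)[l_{\sigma(1)},\dots,l_{\sigma(n)}]$ for all $\sigma\in S_n$. Homomorphisms are linear maps preserving the bracket. Ideals are subspaces $\mathscr{N}$ such that $[l_1,\dots,l_n]\in\mathscr{N}$ whenever some $l_i\in\mathscr{N}$. For $\sigma\in S_n$ put $\langle l_1,\dots,l_n\rangle_\sigma=[l_1,\dots,l_n]-\mathrm{sgn}(\sigma)[l_{\sigma(1)},\dots,l_{\sigma(n)}]$. For ideals $\mathscr{N}_1,\dots,\mathscr{N}_n$ of $\mathscr{L}$, the relative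 commutator $\langle\mathscr{N}_1,\dots,\mathscr{N}_n\rangle$ is the ideal of $\mathscr{L}$ generated by all $\langle l_1,\dots,l_n\rangle_\sigma$ with $l_1\in\mathscr{N}_1,\dots,l_n\in\mathscr{N}_n$ and $\sigma\in S_n$. The left adjoint of the inclusion of Lie $n$-algebras into Leibniz $n$-algebras is $\mathscr{L}\mapsto\mathscr{L}/\langle\mathscr{L},\dots,\mathscr{L}\rangle$. Higher extensions. Let $\langle m\rangle=\{1,\dots,m\}$, $\langle 0\rangle=\varnothing$. An $m$-fold arrow is a functor $f$ from the poset of subsets of $\langle m\rangle$ (ordered by inclusion) to the category of Leibniz $n$-algebras; write $f_I=f(I)$, and $f_i\colon f_\varnothing\to f_{\{i\}}$ for the map induced by $\varnothing\subseteq\{i\}$; $K[f_i]$ is the kernel of $f_i$, an ideal of $f_\varnothing$. An $m$-fold arrow $f$ is an $m$-fold extension if for all $I\subsetneq\langle m\rangle$ the induced map $f_I\to\lim_{J\supsetneq I}f_J$ is surjective; a $0$-fold extension is just an object. For $m\geq1$, $f$ is viewed as a morphism $f\colon\mathscr{B}\to\mathscr{A}$ of $(m-1)$-fold arrows, with $\mathscr{B}_I=f_I$ and $\mathscr{A}_I=f_{I\cup\{m\}}$ for $I\subseteq\langle m-1\rangle$. Its kernel pair $R[f]$ is the $(m-1)$-fold extension with $R[f]_I=\{(x,y)\in\mathscr{B}_I\times\mathscr{B}_I$ : $x,y$ have the same image in $\mathscr{A}_I\}$, with projections $f_0,f_1\colon R[f]\to\mathscr{B}$ onto the first and second component. Higher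 centrality with respect to Lie $n$-algebras. Define inductively, for an $m$-fold extension $f$, an ideal $L_m[f]$ of $f_\varnothing$: $L_0[\mathscr{L}]=\langle\mathscr{L},\dots,\mathscr{L}\rangle$, and for $m\geq 1$, $L_m[f]$ is the kernel of the restriction $L_{m-1}[R[f]]\to L_{m-1}[\mathscr{B}]$ of $(f_0)_\varnothing\colon R[f]_\varnothing\to\mathscr{B}_\varnothing$, viewed as an ideal of $f_\varnothing=\mathscr{B}_\varnothing$ via $(f_1)_\varnothing$; that is, $L_m[f]=\{k\in f_\varnothing:(0,k)\in L_{m-1}[R[f]]\}$. The $m$-fold extension $f$ is central with respect to Lie $n$-algebras if and only if the restrictions of $(f_0)_\varnothing$ and $(f_1)_\varnothing$ to maps $L_{m-1}[R[f]]\to L_{m-1}[\mathscr{B}]$ coincide. The sum in the claim is a sum of ideals of $f_\varnothing$, over all $n$-tuples $(I_1,\dots,I_n)$ of (possibly empty) subsets of $\langle m\rangle$ with union $\langle m\rangle$; an empty intersection means $f_\varnothing$. *)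

theory Defs
  imports "HOL-Algebra.Module" "HOL-Algebra.AbelCoset" "HOL-Combinatorics.Permutations" "HOL.Hull"
begin

section \<open>Leibniz \<open>n\<close>-algebras\<close>

text \<open>Vector spaces are modules over a field; the multiplication and unit which the record
  \<open>module\<close> inherits from rings play no role. The \<open>n\<close>-ary bracket takes its arguments as a list and
  is only meaningful on lists of length \<open>n\<close>; argument positions are counted from 0.\<close>

record ('k, 'a) leibniz = "('k, 'a) module" +
  bracket :: "'a list \<Rightarrow> 'a"

locale leibniz_algebra = module K L + K?: field K
  for K :: "('k, 'c) ring_scheme" and n :: nat and L :: "('k, 'a) leibniz" +
  assumes bracket_closed:
      "\<lbrakk>length ls = n; set ls \<subseteq> carrier L\<rbrakk> \<Longrightarrow> bracket L ls \<in> carrier L"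
    and bracket_add:
      "\<lbrakk>length ls = n; set ls \<subseteq> carrier L; i < n; x \<in> carrier L; y \<in> carrier L\<rbrakk> \<Longrightarrow>
        bracket L (ls[i := x \<oplus>\<^bsub>L\<^esub> y]) = bracket L (ls[i := x]) \<oplus>\<^bsub>L\<^esub> bracket L (ls[i := y])"
    and bracket_smult:
      "\<lbrakk>length ls = n; set ls \<subseteq> carrier L; i < n; a \<in> carrier K; x \<in> carrier L\<rbrakk> \<Longrightarrow>
        bracket L (ls[i := a \<odot>\<^bsub>L\<^esub> x]) = a \<odot>\<^bsub>L\<^esub> bracket L (ls[i := x])"
    and leibniz_identity:
      "\<lbrakk>length ls = n; set ls \<subseteq> carrier L; length ls' = n - 1; set ls' \<subseteq> carrier L\<rbrakk> \<Longrightarrow>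
        bracket L (bracket L ls # ls') =
          (\<Oplus>\<^bsub>L\<^esub>i\<in>{..<n}. bracket L (ls[i := bracket L (ls ! i # ls')]))"

definition leibniz_hom ::
  "('k, 'c) ring_scheme \<Rightarrow> nat \<Rightarrow> ('k, 'a) leibniz \<Rightarrow> ('k, 'b) leibniz \<Rightarrow> ('a \<Rightarrow> 'b) set" where
  "leibniz_hom K n L M = {h \<in> carrier L \<rightarrow> carrier M.
     (\<forall>x\<in>carrier L. \<forall>y\<in>carrier L. h (x \<oplus>\<^bsub>L\<^esub> y) = h x \<oplus>\<^bsub>M\<^esub> h y) \<and>
     (\<forall>a\<in>carrier K. \<forall>x\<in>carrier L. h (a \<odot>\<^bsub>L\<^esub> x) = a \<odot>\<^bsub>M\<^esub> h x) \<and>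
     (\<forall>ls. length ls = n \<and> set ls \<subseteq> carrier L \<longrightarrow> h (bracket L ls) = bracket M (map h ls))}"

definition leibniz_ideal ::
  "('k, 'c) ring_scheme \<Rightarrow> nat \<Rightarrow> ('k, 'a) leibniz \<Rightarrow> 'a set \<Rightarrow> bool" where
  "leibniz_ideal K n L N \<longleftrightarrow> submodule N K L \<and>
     (\<forall>ls. length ls = n \<and> set ls \<subseteq> carrier L \<and> (\<exists>i<n. ls ! i \<in> N) \<longrightarrow> bracket L ls \<in> N)"

text \<open>The element \<open>\<langle>l\<^sub>1, \<dots>, l\<^sub>n\<rangle>\<^sub>\<sigma>\<close>.\<close>

definition skew_defect :: "('k, 'a) leibniz \<Rightarrow> (nat \<Rightarrow> nat) \<Rightarrow> 'a list \<Rightarrow> 'a" where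
  "skew_defect L \<sigma> ls = bracket L ls \<ominus>\<^bsub>L\<^esub> [sign \<sigma>] \<cdot>\<^bsub>L\<^esub> bracket L (permute_list \<sigma> ls)"

definition rel_commutator ::
  "('k, 'c) ring_scheme \<Rightarrow> nat \<Rightarrow> ('k, 'a) leibniz \<Rightarrow> 'a set list \<Rightarrow> 'a set" where
  "rel_commutator K n L Ns = leibniz_ideal K n L hull
     {skew_defect L \<sigma> ls | \<sigma> ls. \<sigma> permutes {..<n} \<and> length ls = n \<and> list_all2 (\<in>) ls Ns}"

text \<open>Sum of a finite family of subspaces: all sums of one element from each member.\<close>

definition family_sum :: "('k, 'a) leibniz \<Rightarrow> 'i set \<Rightarrow> ('i \<Rightarrow> 'a set) \<Rightarrow> 'a set" where
  "family_sum L T N = {(\<Oplus>\<^bsub>L\<^esub>t\<in>T. x t) | x. x \<in> (\<Pi> t\<in>T. N t)}"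


section \<open>Higher extensions\<close>

text \<open>Only the values at \<open>I\<close>, \<open>J\<close> with \<open>I \<subseteq> J \<subseteq> {1..m}\<close> matter for an \<open>m\<close>-fold arrow. All its objects
  live on subsets of a common type; since they are finitely many, this is no loss of generality.\<close>

record ('k, 'a) fold_arrow =
  obj :: "nat set \<Rightarrow> ('k, 'a) leibniz"
  mor :: "nat set \<Rightarrow> nat set \<Rightarrow> 'a \<Rightarrow> 'a"

definition is_fold_arrow ::
  "('k, 'c) ring_scheme \<Rightarrow> nat \<Rightarrow> nat \<Rightarrow> ('k, 'a) fold_arrow \<Rightarrow> bool" where
  "is_fold_arrow K n m f \<longleftrightarrow>
     (\<forall>I. I \<subseteq> {1..m} \<longrightarrow> leibniz_algebra K n (obj f I)) \<and>
     (\<forall>I J. I \<subseteq> J \<and> J \<subseteq> {1..m} \<longrightarrow> mor f I J \<in> leibniz_hom K n (obj f I) (obj f J)) \<and>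
     (\<forall>I. I \<subseteq> {1..m} \<longrightarrow> (\<forall>x\<in>carrier (obj f I). mor f I I x = x)) \<and>
     (\<forall>I J H. I \<subseteq> J \<and> J \<subseteq> H \<and> H \<subseteq> {1..m} \<longrightarrow>
        (\<forall>x\<in>carrier (obj f I). mor f J H (mor f I J x) = mor f I H x))"

text \<open>The (underlying set of the) limit of the \<open>f\<^sub>J\<close> with \<open>J\<close> strictly above \<open>I\<close>, as compatible families.\<close>

definition limit_above :: "nat \<Rightarrow> ('k, 'a) fold_arrow \<Rightarrow> nat set \<Rightarrow> (nat set \<Rightarrow> 'a) set" where
  "limit_above m f I = {x \<in> (\<Pi>\<^sub>E J\<in>{J. I \<subset> J \<and> J \<subseteq> {1..m}}. carrier (obj f J)).
     \<forall>J H. I \<subset> J \<and> J \<subseteq> H \<and> H \<subseteq> {1..m} \<longrightarrow> mor f J H (x J) = x H}"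

definition is_fold_extension ::
  "('k, 'c) ring_scheme \<Rightarrow> nat \<Rightarrow> nat \<Rightarrow> ('k, 'a) fold_arrow \<Rightarrow> bool" where
  "is_fold_extension K n m f \<longleftrightarrow> is_fold_arrow K n m f \<and>
     (\<forall>I. I \<subset> {1..m} \<longrightarrow>
        (\<lambda>a. \<lambda>J\<in>{J. I \<subset> J \<and> J \<subseteq> {1..m}}. mor f I J a) ` carrier (obj f I) = limit_above m f I)"

text \<open>\<open>K[f\<^sub>i]\<close>, and the intersection of these over \<open>I\<close>, which is \<open>f\<^sub>\<emptyset>\<close> if \<open>I\<close> is empty.\<close>

definition kernel_at :: "('k, 'a) fold_arrow \<Rightarrow> nat \<Rightarrow> 'a set" where
  "kernel_at f i = a_kernel (obj f {}) (obj f {i}) (mor f {} {i})"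

definition kernel_meet :: "('k, 'a) fold_arrow \<Rightarrow> nat set \<Rightarrow> 'a set" where
  "kernel_meet f I = carrier (obj f {}) \<inter> (\<Inter>i\<in>I. kernel_at f i)"


section \<open>Kernel pairs and higher centrality\<close>

text \<open>Iterating kernel pairs means forming pairs of pairs etc.; for the recursion on \<open>m\<close> below to be
  typable, all of these have to live in one type. Hence the elements of the algebras are taken from
  a type closed under pairing. The type \<open>'a\<close> of atoms is arbitrary, so that (by transport along
  \<open>Atom\<close>) every Leibniz \<open>n\<close>-algebra is covered up to isomorphism.\<close>

datatype 'a nest = Atom 'a | Couple (proj0: "'a nest") (proj1: "'a nest")

text \<open>The \<open>m\<close>-fold arrow \<open>f\<close> is viewed as a morphism with components
  \<open>mor f I (I \<union> {m})\<close> for \<open>I \<subseteq> {1..m-1}\<close>; operations and maps on the kernel pair are componentwise.\<close>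

definition kernel_pair :: "nat \<Rightarrow> ('k, 'a nest) fold_arrow \<Rightarrow> ('k, 'a nest) fold_arrow" where
  "kernel_pair m f =
    \<lparr>obj = (\<lambda>I.
       \<lparr>carrier = {Couple x y | x y. x \<in> carrier (obj f I) \<and> y \<in> carrier (obj f I) \<and>
                     mor f I (I \<union> {m}) x = mor f I (I \<union> {m}) y},
        monoid.mult = (\<lambda>z w. Couple (proj0 z \<otimes>\<^bsub>obj f I\<^esub> proj0 w) (proj1 z \<otimes>\<^bsub>obj f I\<^esub> proj1 w)),
        one = Couple \<one>\<^bsub>obj f I\<^esub> \<one>\<^bsub>obj f I\<^esub>,
        zero = Couple \<zero>\<^bsub>obj f I\<^esub> \<zero>\<^bsub>obj f I\<^esub>,
        add = (\<lambda>z w. Couple (proj0 z \<oplus>\<^bsub>obj f I\<^esub> proj0 w) (proj1 z \<oplus>\<^bsub>obj f I\<^esub> proj1 w)),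
        smult = (\<lambda>a z. Couple (a \<odot>\<^bsub>obj f I\<^esub> proj0 z) (a \<odot>\<^bsub>obj f I\<^esub> proj1 z)),
        bracket = (\<lambda>zs. Couple (bracket (obj f I) (map proj0 zs))
                               (bracket (obj f I) (map proj1 zs)))\<rparr>),
     mor = (\<lambda>I J z. Couple (mor f I J (proj0 z)) (mor f I J (proj1 z)))\<rparr>"

text \<open>The ideal \<open>L\<^sub>m[f]\<close> of \<open>f\<^sub>\<emptyset>\<close>.\<close>

fun higher_L ::
  "('k, 'c) ring_scheme \<Rightarrow> nat \<Rightarrow> nat \<Rightarrow> ('k, 'a nest) fold_arrow \<Rightarrow> 'a nest set" where
  "higher_L K n 0 f = rel_commutator K n (obj f {}) (replicate n (carrier (obj f {})))"
| "higher_L K n (Suc m) f =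
     {k \<in> carrier (obj f {}). Couple \<zero>\<^bsub>obj f {}\<^esub> k \<in> higher_L K n m (kernel_pair (Suc m) f)}"

text \<open>Centrality of an \<open>m\<close>-fold extension (\<open>m \<ge> 1\<close>) with respect to Lie \<open>n\<close>-algebras.\<close>

definition lie_central ::
  "('k, 'c) ring_scheme \<Rightarrow> nat \<Rightarrow> nat \<Rightarrow> ('k, 'a nest) fold_arrow \<Rightarrow> bool" where
  "lie_central K n m f \<longleftrightarrow>
     (\<forall>z\<in>higher_L K n (m - 1) (kernel_pair m f). proj0 z = proj1 z)"

end

theory Submission
  imports Defs
begin

text \<open>The iterated kernel pairs are eliminated by describing \<open>L\<^sub>m[f]\<close> through tuples of elements of
  \<open>f\<^sub>\<emptyset>\<close> alone: it is the ideal \<open>J\<^sub>m(f)\<close> (\<open>cover_ideal\<close>) generated by the defects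
  \<open>\<langle>l\<^sub>1, \<dots>, l\<^sub>n\<rangle>\<^sub>\<sigma>\<close> of those tuples for which each of the kernels \<open>K[f\<^sub>1], \<dots>, K[f\<^sub>m]\<close> contains at
  least one entry. A tuple has this property exactly when \<open>l\<^sub>p\<close> lies in \<open>\<Inter>\<^sub>i\<^sub>\<in>\<^sub>I K[f\<^sub>i]\<close> with \<open>I = I\<^sub>p\<close> for
  some \<open>I\<^sub>1, \<dots>, I\<^sub>n\<close> covering \<open>{1..m}\<close>; hence \<open>J\<^sub>m(f)\<close> vanishes precisely when all the relative
  commutators in the claim do (\<open>cover_ideal_zero_iff_family_sum\<close>).

  The passage from \<open>m - 1\<close> to \<open>m\<close> compares \<open>J\<^sub>m(f)\<close> with \<open>J\<^sub>m\<^sub>-\<^sub>1(R)\<close>, where \<open>R\<close> is the kernel pair of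
  \<open>f : \<B> \<rightarrow> \<A>\<close>. If \<open>l\<^sub>q \<in> K[f\<^sub>m]\<close>, then the pairs \<open>(l\<^sub>p, l\<^sub>p)\<close> for \<open>p \<noteq> q\<close> together with \<open>(0, l\<^sub>q)\<close> have
  the defect \<open>(0, \<langle>l\<^sub>1, \<dots>, l\<^sub>n\<rangle>\<^sub>\<sigma>)\<close>; this sends \<open>k \<in> J\<^sub>m(f)\<close> to \<open>(0, k) \<in> J\<^sub>m\<^sub>-\<^sub>1(R)\<close>
  (\<open>cover_ideal_to_pairs\<close>). Conversely every \<open>(x, y) \<in> J\<^sub>m\<^sub>-\<^sub>1(R)\<close> satisfies \<open>x \<in> J\<^sub>m\<^sub>-\<^sub>1(\<B>)\<close> and
  \<open>y - x \<in> J\<^sub>m(f)\<close> (\<open>cover_ideal_of_pairs\<close>): generators satisfy it because a defect of pairs can be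
  changed one slot at a time, each change inserting a difference \<open>y\<^sub>j - x\<^sub>j \<in> K[f\<^sub>m]\<close>. That the property
  survives brackets with arbitrary elements of \<open>R\<close> is the crucial point, and it comes down to
  \<open>cover_ideal_absorbs\<close>: a bracket with one entry in \<open>J\<^sub>m\<^sub>-\<^sub>1(\<B>)\<close> and another in \<open>K[f\<^sub>m]\<close> lies in
  \<open>J\<^sub>m(f)\<close>. This is where the Leibniz identity enters.

  Both comparisons together give \<open>L\<^sub>m[f] = J\<^sub>m(f)\<close> by induction, and also that the two projections
  agree on \<open>L\<^sub>m\<^sub>-\<^sub>1[R]\<close> if and only if \<open>J\<^sub>m(f) = 0\<close>.\<close>

section \<open>Ideals generated by skew defects\<close>

lemma permute_list_update:
  assumes "\<sigma> permutes {..<length xs}" "i < length xs"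
  shows "permute_list \<sigma> (xs[\<sigma> i := x]) = (permute_list \<sigma> xs)[i := x]"
proof (rule nth_equalityI)
  fix j assume "j < length (permute_list \<sigma> (xs[\<sigma> i := x]))"
  then have j: "j < length xs" by simp
  have lt: "\<sigma> k < length xs" if "k < length xs" for k
    using permutes_in_image[OF assms(1)] that by auto
  have "\<sigma> j = \<sigma> i \<longleftrightarrow> j = i"
    using permutes_inj[OF assms(1)] by (auto dest: injD)
  then show "permute_list \<sigma> (xs[\<sigma> i := x]) ! j = (permute_list \<sigma> xs)[i := x] ! j"
    using assms j lt by (auto simp: permute_list_nth nth_list_update)
qed simp

text \<open>Instead of quantifying over covers \<open>I\<^sub>1 \<union> \<dots> \<union> I\<^sub>n = S\<close> with
  \<open>l\<^sub>p \<in> N\<^sub>i\<close> for all \<open>i \<in> I\<^sub>p\<close>, it suffices to ask that every index \<open>i \<in> S\<close> is served by some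
  entry: the sets \<open>I\<^sub>p = {i \<in> S. l\<^sub>p \<in> N\<^sub>i}\<close> form such a cover.\<close>

definition cover_defects :: "('k, 'a) leibniz \<Rightarrow> nat \<Rightarrow> (nat \<Rightarrow> 'a set) \<Rightarrow> nat set \<Rightarrow> 'a set" where
  "cover_defects L n N S = {skew_defect L \<sigma> ls | \<sigma> ls. \<sigma> permutes {..<n} \<and> length ls = n \<and>
     set ls \<subseteq> carrier L \<and> (\<forall>i\<in>S. \<exists>p<n. ls ! p \<in> N i)}"

definition cover_ideal ::
  "('k, 'c) ring_scheme \<Rightarrow> nat \<Rightarrow> ('k, 'a) leibniz \<Rightarrow> (nat \<Rightarrow> 'a set) \<Rightarrow> nat set \<Rightarrow> 'a set" where
  "cover_ideal K n L N S = leibniz_ideal K n L hull cover_defects L n N S"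

lemma cover_ideal_antimono:
  assumes "S \<subseteq> T"
  shows "cover_ideal K n L N T \<subseteq> cover_ideal K n L N S"
proof -
  have "cover_defects L n N T \<subseteq> cover_defects L n N S"
    using assms unfolding cover_defects_def by blast
  then show ?thesis unfolding cover_ideal_def by (rule hull_mono)
qed

lemma cover_ideal_cong:
  assumes "\<And>i. i \<in> S \<Longrightarrow> N i = N' i"
  shows "cover_ideal K n L N S = cover_ideal K n L N' S"
proof -
  have "(\<forall>i\<in>S. \<exists>p<n. ls ! p \<in> N i) \<longleftrightarrow> (\<forall>i\<in>S. \<exists>p<n. ls ! p \<in> N' i)" for ls
    using assms by auto
  then show ?thesis by (simp only: cover_ideal_def cover_defects_def)
qed

text \<open>The scalar \<open>-sgn(\<sigma>)\<close>. With it the skew defect becomes a linear combination of two brackets,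
  so that the linearity laws of the module apply without distinguishing the parity of \<open>\<sigma>\<close>.\<close>

definition sign_coeff :: "('k, 'c) ring_scheme \<Rightarrow> (nat \<Rightarrow> nat) \<Rightarrow> 'k" where
  "sign_coeff K \<sigma> = (if evenperm \<sigma> then \<ominus>\<^bsub>K\<^esub> \<one>\<^bsub>K\<^esub> else \<one>\<^bsub>K\<^esub>)"

context leibniz_algebra
begin

lemma set_update_carrier:
  "\<lbrakk>set ls \<subseteq> carrier L; x \<in> carrier L\<rbrakk> \<Longrightarrow> set (ls[i := x]) \<subseteq> carrier L"
  by (meson insert_subset order_trans set_update_subset_insert)

lemma nth_carrier: "\<lbrakk>set ls \<subseteq> carrier L; i < length ls\<rbrakk> \<Longrightarrow> ls ! i \<in> carrier L"
  using nth_mem by blast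

lemma derivation_args:
  assumes "length ls = n" "set ls \<subseteq> carrier L" "i < n" "length ls' = n - 1" "set ls' \<subseteq> carrier L"
  shows "length (ls[i := bracket L (ls ! i # ls')]) = n"
    "set (ls[i := bracket L (ls ! i # ls')]) \<subseteq> carrier L"
    "length (ls ! i # ls') = n" "set (ls ! i # ls') \<subseteq> carrier L"
proof -
  show args: "length (ls ! i # ls') = n" "set (ls ! i # ls') \<subseteq> carrier L"
    using assms nth_carrier[of ls i] by auto
  show "length (ls[i := bracket L (ls ! i # ls')]) = n" using assms by simp
  show "set (ls[i := bracket L (ls ! i # ls')]) \<subseteq> carrier L"
    by (rule set_update_carrier[OF assms(2) bracket_closed[OF args]])
qed

lemma sign_coeff_closed [simp]: "sign_coeff K \<sigma> \<in> carrier K"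
  unfolding sign_coeff_def by simp

lemma permute_carrier:
  "\<lbrakk>\<sigma> permutes {..<n}; length ls = n; set ls \<subseteq> carrier L\<rbrakk> \<Longrightarrow> set (permute_list \<sigma> ls) \<subseteq> carrier L"
  by simp

lemma skew_defect_eq:
  assumes "\<sigma> permutes {..<n}" "length ls = n" "set ls \<subseteq> carrier L"
  shows "skew_defect L \<sigma> ls = bracket L ls \<oplus>\<^bsub>L\<^esub> sign_coeff K \<sigma> \<odot>\<^bsub>L\<^esub> bracket L (permute_list \<sigma> ls)"
proof -
  have c: "bracket L ls \<in> carrier L" "bracket L (permute_list \<sigma> ls) \<in> carrier L"
    using assms by (auto intro!: bracket_closed)
  have one: "[(1::int)] \<cdot>\<^bsub>L\<^esub> x = x" "[(-1::int)] \<cdot>\<^bsub>L\<^esub> x = \<ominus>\<^bsub>L\<^esub> x" if "x \<in> carrier L" for x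
    using that M.add.int_pow_1 M.add.int_pow_neg[of x 1] by simp_all
  show ?thesis
    using c by (cases "evenperm \<sigma>")
      (simp_all add: skew_defect_def sign_coeff_def sign_def one a_minus_def smult_l_minus)
qed

lemma skew_defect_closed:
  assumes "\<sigma> permutes {..<n}" "length ls = n" "set ls \<subseteq> carrier L"
  shows "skew_defect L \<sigma> ls \<in> carrier L"
  using assms by (simp add: skew_defect_eq bracket_closed)

lemma permute_update:
  assumes "\<sigma> permutes {..<n}" "length ls = n" "i < n"
  obtains j where "j < n" "\<And>x. permute_list \<sigma> (ls[i := x]) = (permute_list \<sigma> ls)[j := x]"
proof -
  obtain j where "j < n" "\<sigma> j = i"
    using assms(1,3) by (metis lessThan_iff permutes_in_image permutes_def)
  then show ?thesis using that permute_list_update[of \<sigma> ls j] assms by auto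
qed

lemma skew_defect_add:
  assumes "\<sigma> permutes {..<n}" "length ls = n" "set ls \<subseteq> carrier L" "i < n"
    and "x \<in> carrier L" "y \<in> carrier L"
  shows "skew_defect L \<sigma> (ls[i := x \<oplus>\<^bsub>L\<^esub> y])
    = skew_defect L \<sigma> (ls[i := x]) \<oplus>\<^bsub>L\<^esub> skew_defect L \<sigma> (ls[i := y])"
proof -
  obtain j where j: "j < n" "\<And>x. permute_list \<sigma> (ls[i := x]) = (permute_list \<sigma> ls)[j := x]"
    using permute_update assms by metis
  have c: "bracket L (ls[i := z]) \<in> carrier L" "bracket L ((permute_list \<sigma> ls)[j := z]) \<in> carrier L"
    if "z \<in> carrier L" for z
    using assms that by (intro bracket_closed set_update_carrier; simp)+
  show ?thesis
    using assms c
    by (simp add: skew_defect_eq j set_update_carrier bracket_add[of ls] bracket_add[of "permute_list \<sigma> ls"]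
      smult_r_distr M.add.m_ac)
qed

lemma ideal_props:
  assumes "leibniz_ideal K n L N"
  shows "N \<subseteq> carrier L" "\<zero>\<^bsub>L\<^esub> \<in> N"
    "\<And>x y. \<lbrakk>x \<in> N; y \<in> N\<rbrakk> \<Longrightarrow> x \<oplus>\<^bsub>L\<^esub> y \<in> N"
    "\<And>x y. \<lbrakk>x \<in> N; y \<in> N\<rbrakk> \<Longrightarrow> x \<ominus>\<^bsub>L\<^esub> y \<in> N"
    "\<And>a x. \<lbrakk>a \<in> carrier K; x \<in> N\<rbrakk> \<Longrightarrow> a \<odot>\<^bsub>L\<^esub> x \<in> N"
    "\<And>ls i. \<lbrakk>length ls = n; set ls \<subseteq> carrier L; i < n; ls ! i \<in> N\<rbrakk> \<Longrightarrow> bracket L ls \<in> N"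
proof -
  have s: "submodule N K L" using assms unfolding leibniz_ideal_def by blast
  note e = submoduleE[OF s]
  show "N \<subseteq> carrier L" by (rule e)
  show add: "x \<oplus>\<^bsub>L\<^esub> y \<in> N" if "x \<in> N" "y \<in> N" for x y using e(5) that .
  show "x \<ominus>\<^bsub>L\<^esub> y \<in> N" if "x \<in> N" "y \<in> N" for x y
    using e(3,5) that by (simp add: a_minus_def)
  then show "\<zero>\<^bsub>L\<^esub> \<in> N" using e(1,2) by (metis M.r_neg a_minus_def ex_in_conv subsetD)
  show "a \<odot>\<^bsub>L\<^esub> x \<in> N" if "a \<in> carrier K" "x \<in> N" for a x using e(4) that .
  show "bracket L ls \<in> N" if "length ls = n" "set ls \<subseteq> carrier L" "i < n" "ls ! i \<in> N" for ls i
    using assms that unfolding leibniz_ideal_def by blast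
qed

lemma leibniz_idealI:
  assumes "N \<subseteq> carrier L" "\<zero>\<^bsub>L\<^esub> \<in> N"
    "\<And>x y. \<lbrakk>x \<in> N; y \<in> N\<rbrakk> \<Longrightarrow> x \<oplus>\<^bsub>L\<^esub> y \<in> N"
    "\<And>a x. \<lbrakk>a \<in> carrier K; x \<in> N\<rbrakk> \<Longrightarrow> a \<odot>\<^bsub>L\<^esub> x \<in> N"
    "\<And>ls i. \<lbrakk>length ls = n; set ls \<subseteq> carrier L; i < n; ls ! i \<in> N\<rbrakk> \<Longrightarrow> bracket L ls \<in> N"
  shows "leibniz_ideal K n L N"
proof -
  have "\<ominus>\<^bsub>L\<^esub> x \<in> N" if "x \<in> N" for x
  proof -
    have "\<ominus>\<^bsub>L\<^esub> x = (\<ominus>\<^bsub>K\<^esub> \<one>\<^bsub>K\<^esub>) \<odot>\<^bsub>L\<^esub> x"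
      using that assms(1) by (subst smult_l_minus) auto
    then show ?thesis using assms(4) that by simp
  qed
  then show ?thesis unfolding leibniz_ideal_def
    using assms by (blast intro: submoduleI)
qed

lemma ideal_carrier: "leibniz_ideal K n L (carrier L)"
  by (rule leibniz_idealI) (auto intro: bracket_closed)

lemma ideal_zero: "leibniz_ideal K n L {\<zero>\<^bsub>L\<^esub>}"
proof (rule leibniz_idealI)
  fix ls i assume a: "length ls = n" "set ls \<subseteq> carrier L" "i < n" "ls ! i \<in> {\<zero>\<^bsub>L\<^esub>}"
  then have "bracket L ls = bracket L (ls[i := \<zero>\<^bsub>K\<^esub> \<odot>\<^bsub>L\<^esub> \<zero>\<^bsub>L\<^esub>])"
    by (metis M.zero_closed list_update_id singletonD smult_l_null)
  also have "\<dots> = \<zero>\<^bsub>K\<^esub> \<odot>\<^bsub>L\<^esub> bracket L (ls[i := \<zero>\<^bsub>L\<^esub>])"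
    by (rule bracket_smult) (use a in simp_all)
  also have "\<dots> = \<zero>\<^bsub>L\<^esub>"
    using a by (intro smult_l_null bracket_closed set_update_carrier) simp_all
  finally show "bracket L ls \<in> {\<zero>\<^bsub>L\<^esub>}" by simp
qed auto

lemma ideal_Inter:
  assumes "\<NN> \<noteq> {}" "\<And>N. N \<in> \<NN> \<Longrightarrow> leibniz_ideal K n L N"
  shows "leibniz_ideal K n L (\<Inter>\<NN>)"
proof (rule leibniz_idealI)
  show "\<Inter>\<NN> \<subseteq> carrier L" using assms ideal_props(1) by blast
  show "\<zero>\<^bsub>L\<^esub> \<in> \<Inter>\<NN>" using assms(2) ideal_props(2) by blast
  show "x \<oplus>\<^bsub>L\<^esub> y \<in> \<Inter>\<NN>" if "x \<in> \<Inter>\<NN>" "y \<in> \<Inter>\<NN>" for x y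
    using that ideal_props(3)[OF assms(2)] by blast
  show "a \<odot>\<^bsub>L\<^esub> x \<in> \<Inter>\<NN>" if "a \<in> carrier K" "x \<in> \<Inter>\<NN>" for a x
    using that ideal_props(5)[OF assms(2)] by blast
  show "bracket L ls \<in> \<Inter>\<NN>"
    if "length ls = n" "set ls \<subseteq> carrier L" "i < n" "ls ! i \<in> \<Inter>\<NN>" for ls i
    using that ideal_props(6)[OF assms(2)] by blast
qed

text \<open>The condition on \<open>X\<close> matters: if no ideal contains \<open>X\<close>, the hull is the empty intersection, that
  is, the whole type.\<close>

lemma ideal_hull:
  assumes "X \<subseteq> carrier L"
  shows "leibniz_ideal K n L (leibniz_ideal K n L hull X)"
  unfolding hull_def using assms ideal_carrier by (intro ideal_Inter) auto

lemma skew_defect_in_ideal: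
  assumes "leibniz_ideal K n L N" "\<sigma> permutes {..<n}" "length ls = n" "set ls \<subseteq> carrier L"
    and "p < n" "ls ! p \<in> N"
  shows "skew_defect L \<sigma> ls \<in> N"
proof -
  obtain q where q: "q < n" "\<sigma> q = p"
    using assms(2,5) by (metis lessThan_iff permutes_in_image permutes_def)
  then have "permute_list \<sigma> ls ! q \<in> N" using assms by (simp add: permute_list_nth)
  then have "bracket L (permute_list \<sigma> ls) \<in> N"
    using ideal_props(6)[OF assms(1), of "permute_list \<sigma> ls" q] q assms by simp
  moreover have "bracket L ls \<in> N" using ideal_props(6)[OF assms(1)] assms by blast
  ultimately show ?thesis
    using ideal_props(3,5)[OF assms(1)] assms by (simp add: skew_defect_eq)
qed

lemma cover_defects_carrier: "cover_defects L n N S \<subseteq> carrier L"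
  unfolding cover_defects_def using skew_defect_closed by blast

lemma ideal_cover_ideal: "leibniz_ideal K n L (cover_ideal K n L N S)"
  unfolding cover_ideal_def by (rule ideal_hull[OF cover_defects_carrier])

lemma cover_idealI:
  assumes "\<sigma> permutes {..<n}" "length ls = n" "set ls \<subseteq> carrier L"
    and "\<And>i. i \<in> S \<Longrightarrow> \<exists>p<n. ls ! p \<in> N i"
  shows "skew_defect L \<sigma> ls \<in> cover_ideal K n L N S"
  unfolding cover_ideal_def cover_defects_def by (rule hull_inc) (use assms in blast)

lemma cover_ideal_subset:
  assumes "leibniz_ideal K n L D"
    and "\<And>\<sigma> ls. \<lbrakk>\<sigma> permutes {..<n}; length ls = n; set ls \<subseteq> carrier L;
        \<forall>i\<in>S. \<exists>p<n. ls ! p \<in> N i\<rbrakk> \<Longrightarrow> skew_defect L \<sigma> ls \<in> D"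
  shows "cover_ideal K n L N S \<subseteq> D"
  unfolding cover_ideal_def cover_defects_def
  by (rule hull_minimal) (use assms in blast)+

lemma minus_minus_add:
  assumes "a \<in> carrier L" "b \<in> carrier L" "c \<in> carrier L"
  shows "(a \<ominus>\<^bsub>L\<^esub> b) \<oplus>\<^bsub>L\<^esub> (b \<ominus>\<^bsub>L\<^esub> c) = a \<ominus>\<^bsub>L\<^esub> c"
  using assms by (simp add: a_minus_def M.add.m_assoc M.r_neg1)

lemma minus_zero_right: "x \<in> carrier L \<Longrightarrow> x \<ominus>\<^bsub>L\<^esub> \<zero>\<^bsub>L\<^esub> = x"
  using M.l_zero[of "\<ominus>\<^bsub>L\<^esub> \<zero>\<^bsub>L\<^esub>"] M.r_neg[of "\<zero>\<^bsub>L\<^esub>"] by (simp add: a_minus_def)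

text \<open>Telescoping: \<open>ys\<close> is reached from \<open>xs\<close> by replacing the entries one after the other. By additivity
  the replacement of \<open>x\<^sub>j\<close> by \<open>y\<^sub>j\<close> changes \<open>\<phi>\<close> by its value at a tuple with \<open>y\<^sub>j - x\<^sub>j\<close> in slot \<open>j\<close>.
  It is applied with \<open>\<phi>\<close> the bracket and with \<open>\<phi>\<close> a skew defect.\<close>

lemma slotwise_difference:
  assumes N: "leibniz_ideal K n L N"
    and closed: "\<And>ls. \<lbrakk>length ls = n; set ls \<subseteq> carrier L\<rbrakk> \<Longrightarrow> \<phi> ls \<in> carrier L"
    and additive: "\<And>ls i x y. \<lbrakk>length ls = n; set ls \<subseteq> carrier L; i < n; x \<in> carrier L; y \<in> carrier L\<rbrakk>
      \<Longrightarrow> \<phi> (ls[i := x \<oplus>\<^bsub>L\<^esub> y]) = \<phi> (ls[i := x]) \<oplus>\<^bsub>L\<^esub> \<phi> (ls[i := y])"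
    and xs: "length xs = n" "set xs \<subseteq> carrier L" and ys: "length ys = n" "set ys \<subseteq> carrier L"
    and step: "\<And>zs j. \<lbrakk>length zs = n; set zs \<subseteq> carrier L; j < n; zs ! j = ys ! j \<ominus>\<^bsub>L\<^esub> xs ! j;
        \<forall>i<n. i \<noteq> j \<longrightarrow> zs ! i = xs ! i \<or> zs ! i = ys ! i\<rbrakk> \<Longrightarrow> \<phi> zs \<in> N"
  shows "\<phi> ys \<ominus>\<^bsub>L\<^esub> \<phi> xs \<in> N"
proof -
  define ws where "ws k = take k ys @ drop k xs" for k
  have "\<phi> (ws k) \<ominus>\<^bsub>L\<^esub> \<phi> xs \<in> N" if "k \<le> n" for k
    using that
  proof (induction k)
    case 0
    show ?case
      using closed[OF xs] ideal_props(2)[OF N] by (simp add: ws_def a_minus_def M.r_neg)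
  next
    case (Suc k)
    then have k: "k < n" by simp
    have len: "length (ws i) = n" if "i \<le> n" for i using that xs ys by (simp add: ws_def)
    have set: "set (ws i) \<subseteq> carrier L" for i
      using xs ys set_take_subset[of i ys] set_drop_subset[of i xs] unfolding ws_def by auto
    have "ws (Suc k) = (ws k)[k := ys ! k]" "ws k = (ws k)[k := xs ! k]"
      using k xs ys unfolding ws_def
      by (auto intro!: nth_equalityI simp: nth_append nth_list_update less_Suc_eq)
    note w = this
    have c: "xs ! k \<in> carrier L" "ys ! k \<in> carrier L" using xs ys k nth_carrier by auto
    define zs where "zs = (ws k)[k := ys ! k \<ominus>\<^bsub>L\<^esub> xs ! k]"
    have zs: "length zs = n" "set zs \<subseteq> carrier L"
      using c k by (simp_all add: zs_def len set set_update_carrier)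
    have "\<phi> zs \<in> N"
      using xs ys k by (intro step[of zs k] zs) (auto simp: zs_def ws_def nth_append nth_list_update)
    moreover have "\<phi> zs = \<phi> (ws (Suc k)) \<ominus>\<^bsub>L\<^esub> \<phi> (ws k)"
    proof -
      have cl: "\<phi> (ws k) \<in> carrier L" "\<phi> (ws (Suc k)) \<in> carrier L" "\<phi> zs \<in> carrier L"
        using zs Suc.prems by (simp_all add: closed len set)
      have "ys ! k = (ys ! k \<ominus>\<^bsub>L\<^esub> xs ! k) \<oplus>\<^bsub>L\<^esub> xs ! k"
        using c by (simp add: a_minus_def M.add.m_assoc M.l_neg)
      then have "\<phi> (ws (Suc k)) = \<phi> zs \<oplus>\<^bsub>L\<^esub> \<phi> (ws k)"
        using additive[of "ws k" k "ys ! k \<ominus>\<^bsub>L\<^esub> xs ! k" "xs ! k"] c k len set w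
        by (simp add: zs_def)
      then show ?thesis using cl by (simp add: a_minus_def M.add.m_assoc M.r_neg)
    qed
    ultimately have "(\<phi> (ws (Suc k)) \<ominus>\<^bsub>L\<^esub> \<phi> (ws k)) \<oplus>\<^bsub>L\<^esub> (\<phi> (ws k) \<ominus>\<^bsub>L\<^esub> \<phi> xs) \<in> N"
      using Suc ideal_props(3)[OF N] by simp
    then show ?case
      using Suc.prems by (simp add: minus_minus_add closed len set xs)
  qed
  from this[of n] show ?thesis using xs ys by (simp add: ws_def)
qed

lemma finsum_in_ideal:
  assumes "leibniz_ideal K n L N" "finite A" "\<And>i. i \<in> A \<Longrightarrow> f i \<in> N"
  shows "(\<Oplus>\<^bsub>L\<^esub>i\<in>A. f i) \<in> N"
  using assms(2,3)
proof (induction A)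
  case (insert a A)
  then have "f \<in> A \<rightarrow> carrier L" "f a \<in> carrier L" using ideal_props(1)[OF assms(1)] by auto
  then show ?case using insert ideal_props(3)[OF assms(1)] by simp
qed (simp add: ideal_props(2)[OF assms(1)])

text \<open>Bracketing with \<open>l'\<close> on the right is a derivation, by the Leibniz identity. Expanding the
  permuted bracket in the same way yields the terms of the first expansion in the order given by
  \<open>\<sigma>\<close>, each one permuted; hence the derivation passes through the skew defect.\<close>

lemma bracket_skew_defect:
  assumes \<sigma>: "\<sigma> permutes {..<n}" and ls: "length ls = n" "set ls \<subseteq> carrier L"
    and ls': "length ls' = n - 1" "set ls' \<subseteq> carrier L" and "n > 0"
  shows "bracket L (skew_defect L \<sigma> ls # ls') =
    (\<Oplus>\<^bsub>L\<^esub>i\<in>{..<n}. skew_defect L \<sigma> (ls[i := bracket L (ls ! i # ls')]))"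
proof -
  define F where "F i = ls[i := bracket L (ls ! i # ls')]" for i
  have F: "length (F i) = n" "set (F i) \<subseteq> carrier L" if "i < n" for i
    unfolding F_def using derivation_args[OF ls that ls'] by simp_all
  have c: "bracket L (F i) \<in> carrier L" "bracket L (permute_list \<sigma> (F i)) \<in> carrier L"
    if "i < n" for i
    using F[OF that] \<sigma> by (simp_all add: bracket_closed)
  have p: "length (permute_list \<sigma> ls) = n" "set (permute_list \<sigma> ls) \<subseteq> carrier L"
    using \<sigma> ls by auto
  have \<sigma>_lt: "\<sigma> i < n" if "i < n" for i using permutes_in_image[OF \<sigma>] that by auto
  have one: "bracket L (bracket L ls # ls') = (\<Oplus>\<^bsub>L\<^esub>i\<in>{..<n}. bracket L (F i))"
    using leibniz_identity[OF ls ls'] by (simp add: F_def)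
  have "bracket L (bracket L (permute_list \<sigma> ls) # ls')
      = (\<Oplus>\<^bsub>L\<^esub>i\<in>{..<n}. bracket L ((permute_list \<sigma> ls)[i := bracket L (permute_list \<sigma> ls ! i # ls')]))"
    using leibniz_identity[OF p ls'] .
  also have "\<dots> = (\<Oplus>\<^bsub>L\<^esub>i\<in>{..<n}. bracket L (permute_list \<sigma> (F (\<sigma> i))))"
  proof (rule M.finsum_cong')
    show "bracket L ((permute_list \<sigma> ls)[i := bracket L (permute_list \<sigma> ls ! i # ls')])
        = bracket L (permute_list \<sigma> (F (\<sigma> i)))" if "i \<in> {..<n}" for i
      using that \<sigma> ls by (simp add: F_def permute_list_update permute_list_nth)
  qed (use c \<sigma>_lt in auto)
  also have "\<dots> = (\<Oplus>\<^bsub>L\<^esub>i\<in>\<sigma> ` {..<n}. bracket L (permute_list \<sigma> (F i)))"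
    using c \<sigma>_lt permutes_inj_on[OF \<sigma>] by (intro M.finsum_reindex[symmetric]) auto
  finally have two: "bracket L (bracket L (permute_list \<sigma> ls) # ls')
      = (\<Oplus>\<^bsub>L\<^esub>i\<in>{..<n}. bracket L (permute_list \<sigma> (F i)))"
    using permutes_image[OF \<sigma>] by simp
  have zero: "length (\<zero>\<^bsub>L\<^esub> # ls') = n" "set (\<zero>\<^bsub>L\<^esub> # ls') \<subseteq> carrier L" using ls' \<open>n > 0\<close> by auto
  have cl: "bracket L ls \<in> carrier L" "bracket L (permute_list \<sigma> ls) \<in> carrier L"
    using ls p by (auto intro!: bracket_closed)
  have "bracket L (skew_defect L \<sigma> ls # ls')
    = bracket L (bracket L ls # ls') \<oplus>\<^bsub>L\<^esub> sign_coeff K \<sigma> \<odot>\<^bsub>L\<^esub> bracket L (bracket L (permute_list \<sigma> ls) # ls')"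
    using bracket_add[OF zero \<open>n > 0\<close>, of "bracket L ls" "sign_coeff K \<sigma> \<odot>\<^bsub>L\<^esub> bracket L (permute_list \<sigma> ls)"]
      bracket_smult[OF zero \<open>n > 0\<close>, of "sign_coeff K \<sigma>" "bracket L (permute_list \<sigma> ls)"] cl
    by (simp add: skew_defect_eq[OF \<sigma> ls])
  also have "\<dots> = (\<Oplus>\<^bsub>L\<^esub>i\<in>{..<n}. bracket L (F i) \<oplus>\<^bsub>L\<^esub> sign_coeff K \<sigma> \<odot>\<^bsub>L\<^esub> bracket L (permute_list \<sigma> (F i)))"
    using c by (simp add: one two finsum_smult_ldistr M.finsum_addf Pi_def)
  also have "\<dots> = (\<Oplus>\<^bsub>L\<^esub>i\<in>{..<n}. skew_defect L \<sigma> (F i))"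
    using \<sigma> F c by (intro M.finsum_cong') (auto simp: skew_defect_eq intro!: skew_defect_closed)
  finally show ?thesis unfolding F_def .
qed

lemma cover_ideal_in_members:
  assumes "\<And>i. i \<in> S \<Longrightarrow> leibniz_ideal K n L (N i)" "i \<in> S"
  shows "cover_ideal K n L N S \<subseteq> N i"
proof (rule cover_ideal_subset)
  fix \<sigma> ls assume ls: "\<sigma> permutes {..<n}" "length ls = n" "set ls \<subseteq> carrier L"
    "\<forall>i\<in>S. \<exists>p<n. ls ! p \<in> N i"
  then obtain p where "p < n" "ls ! p \<in> N i" using assms(2) by blast
  then show "skew_defect L \<sigma> ls \<in> N i"
    using skew_defect_in_ideal[OF assms(1)] ls assms(2) by blast
qed (use assms in blast)

text \<open>Consider the elements \<open>x\<close> of \<open>\<Inter>\<^sub>i\<^sub>\<in>\<^sub>S N\<^sub>i\<close> such that \<open>[x, l'\<^sub>1, \<dots>, l'\<^sub>n\<^sub>-\<^sub>1]\<close> lies in the target \<open>J\<close>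
  whenever some \<open>l'\<^sub>j\<close> is in \<open>N\<^sub>m\<close>. They form an ideal \<open>Z\<close> containing the generators, which is proved as
  follows. The slot of \<open>x\<close> is immaterial, since exchanging \<open>x\<close> with the first entry costs, up to
  sign, a skew defect of a tuple in which \<open>x\<close> serves all of \<open>S\<close> and \<open>l'\<^sub>j\<close> serves \<open>m\<close>, an element of
  \<open>J\<close>. For a bracket \<open>[a\<^sub>1, \<dots>, x, \<dots>, a\<^sub>n]\<close> the Leibniz identity leaves the terms in which \<open>l'\<close>
  acts on \<open>x\<close>, giving an entry in \<open>J\<close>, and those in which it acts on another \<open>a\<^sub>i\<close>, giving an
  entry in \<open>N\<^sub>m\<close> next to the untouched \<open>x\<close>. For a generator the derivation rule
  produces defects in which the entry acted upon remains in its old ideals and moreover is in \<open>N\<^sub>m\<close>.\<close>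

lemma cover_ideal_absorbs:
  assumes N: "\<And>i. i \<in> insert m S \<Longrightarrow> leibniz_ideal K n L (N i)"
    and zs: "length zs = n" "set zs \<subseteq> carrier L" "p < n" "j < n" "p \<noteq> j"
    and x: "zs ! p \<in> cover_ideal K n L N S" and k: "zs ! j \<in> N m"
  shows "bracket L zs \<in> cover_ideal K n L N (insert m S)"
proof -
  let ?J = "cover_ideal K n L N (insert m S)"
  note J = ideal_props[OF ideal_cover_ideal[of N "insert m S"]]
  have npos: "n > 0" using zs by simp
  \<comment> \<open>Exchange of slots \<open>0\<close> and \<open>p\<close>, modulo a generator of the target ideal.\<close>
  have head: "bracket L (g # ls') \<in> ?J \<Longrightarrow> bracket L zs \<in> ?J"
    if "g = zs ! p" "ls' = tl (permute_list (transpose 0 p) zs)" "\<forall>i\<in>S. zs ! p \<in> N i"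
      "length zs = n" "set zs \<subseteq> carrier L" "p < n" "j < n" "p \<noteq> j" "zs ! j \<in> N m" for g ls' zs p j
  proof -
    let ?\<tau> = "transpose 0 p"
    have \<tau>: "?\<tau> permutes {..<n}" using that by (intro permutes_swap_id) auto
    assume br: "bracket L (g # ls') \<in> ?J"
    have eq: "g # ls' = permute_list ?\<tau> zs"
      using that by (intro nth_equalityI)
        (auto simp: nth_Cons nth_tl permute_list_nth \<tau> split: nat.splits)
    have "skew_defect L ?\<tau> zs \<in> ?J"
      using that \<tau> by (intro cover_idealI) auto
    then have "skew_defect L ?\<tau> zs \<ominus>\<^bsub>L\<^esub> sign_coeff K ?\<tau> \<odot>\<^bsub>L\<^esub> bracket L (permute_list ?\<tau> zs) \<in> ?J"
      using br eq J(4,5) by simp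
    then show ?thesis
      using that \<tau> by (simp add: skew_defect_eq bracket_closed a_minus_def M.add.m_assoc M.r_neg)
  qed
  define Z where "Z = {x \<in> carrier L. (\<forall>i\<in>S. x \<in> N i) \<and>
    (\<forall>ls'. length ls' = n - 1 \<and> set ls' \<subseteq> carrier L \<and> (\<exists>j<n - 1. ls' ! j \<in> N m) \<longrightarrow> bracket L (x # ls') \<in> ?J)}"
  have any_slot: "bracket L zs \<in> ?J"
    if "length zs = n" "set zs \<subseteq> carrier L" "p < n" "j < n" "p \<noteq> j" "zs ! p \<in> Z" "zs ! j \<in> N m" for zs p j
  proof -
    let ?\<tau> = "transpose 0 p"
    let ?ls' = "tl (permute_list ?\<tau> zs)"
    have \<tau>: "?\<tau> permutes {..<n}" using that by (intro permutes_swap_id) auto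
    have len: "length ?ls' = n - 1" using that by simp
    have set: "set ?ls' \<subseteq> carrier L"
      using that \<tau> list.set_sel(2)[of "permute_list ?\<tau> zs"]
      by (metis permute_carrier list.sel(2) order_trans set_subset_Cons list.exhaust_sel)
    have "\<exists>i<n - 1. ?ls' ! i \<in> N m"
    proof -
      have "?\<tau> j \<noteq> 0" "?\<tau> j < n" "?\<tau> (?\<tau> j) = j"
        using that by (auto simp: transpose_def)
      then show ?thesis
        using that len \<tau> by (intro exI[of _ "?\<tau> j - 1"]) (auto simp: nth_tl permute_list_nth)
    qed
    then have "bracket L (zs ! p # ?ls') \<in> ?J" using that(6) len set unfolding Z_def by blast
    moreover have "\<forall>i\<in>S. zs ! p \<in> N i" using that(6) unfolding Z_def by blast
    ultimately show ?thesis using head[OF refl refl, of zs p j] that by blast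
  qed
  have Z_ideal: "leibniz_ideal K n L Z"
  proof (rule leibniz_idealI)
    have Ni: "leibniz_ideal K n L (N i)" if "i \<in> S" for i using N that by simp
    have zero: "length (\<zero>\<^bsub>L\<^esub> # ls') = n" "set (\<zero>\<^bsub>L\<^esub> # ls') \<subseteq> carrier L"
      if "length ls' = n - 1" "set ls' \<subseteq> carrier L" for ls'
      using that npos by auto
    show "Z \<subseteq> carrier L" unfolding Z_def by blast
    show "\<zero>\<^bsub>L\<^esub> \<in> Z"
    proof -
      have "bracket L (\<zero>\<^bsub>L\<^esub> # ls') = \<zero>\<^bsub>L\<^esub>" if "length ls' = n - 1" "set ls' \<subseteq> carrier L" for ls'
        using ideal_props(6)[OF ideal_zero zero[OF that] npos] by simp
      then show ?thesis unfolding Z_def using ideal_props(2)[OF Ni] J(2) by auto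
    qed
    show "x \<oplus>\<^bsub>L\<^esub> y \<in> Z" if "x \<in> Z" "y \<in> Z" for x y
    proof -
      have "bracket L ((x \<oplus>\<^bsub>L\<^esub> y) # ls') = bracket L (x # ls') \<oplus>\<^bsub>L\<^esub> bracket L (y # ls')"
        if "length ls' = n - 1" "set ls' \<subseteq> carrier L" for ls'
        using bracket_add[OF zero[OF that] npos, of x y] \<open>x \<in> Z\<close> \<open>y \<in> Z\<close> by (simp add: Z_def)
      then show ?thesis using that ideal_props(3)[OF Ni] J(3) unfolding Z_def by auto
    qed
    show "a \<odot>\<^bsub>L\<^esub> x \<in> Z" if "a \<in> carrier K" "x \<in> Z" for a x
    proof -
      have "bracket L ((a \<odot>\<^bsub>L\<^esub> x) # ls') = a \<odot>\<^bsub>L\<^esub> bracket L (x # ls')"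
        if "length ls' = n - 1" "set ls' \<subseteq> carrier L" for ls'
        using bracket_smult[OF zero[OF that] npos, of a x] \<open>x \<in> Z\<close> \<open>a \<in> carrier K\<close> by (simp add: Z_def)
      then show ?thesis using that ideal_props(5)[OF Ni] J(5) unfolding Z_def by auto
    qed
    fix as p assume as: "length as = n" "set as \<subseteq> carrier L" "p < n" "as ! p \<in> Z"
    have "bracket L (bracket L as # ls') \<in> ?J"
      if ls': "length ls' = n - 1" "set ls' \<subseteq> carrier L" and j: "j < n - 1" "ls' ! j \<in> N m" for ls' j
    proof -
      have "bracket L (as[i := bracket L (as ! i # ls')]) \<in> ?J" if "i < n" for i
      proof -
        note up = derivation_args(1,2)[OF as(1,2) that ls']
        note args = derivation_args(3,4)[OF as(1,2) that ls']
        show ?thesis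
        proof (cases "i = p")
          case True
          then have "bracket L (as ! i # ls') \<in> ?J" using as ls' j unfolding Z_def by blast
          then show ?thesis using J(6)[OF up that] as that by simp
        next
          case False
          have "bracket L (as ! i # ls') \<in> N m"
            using ideal_props(6)[OF N args, of m "Suc j"] j by simp
          then show ?thesis using any_slot[OF up as(3) that] False as that by simp
        qed
      qed
      then show ?thesis
        unfolding leibniz_identity[OF as(1,2) ls']
        by (intro finsum_in_ideal[OF ideal_cover_ideal]) simp_all
    qed
    then show "bracket L as \<in> Z"
      using as ideal_props(6)[OF Ni as(1,2,3)] unfolding Z_def by (auto intro: bracket_closed)
  qed
  have "cover_ideal K n L N S \<subseteq> Z"
  proof (rule cover_ideal_subset[OF Z_ideal])
    fix \<sigma> ls assume ls: "\<sigma> permutes {..<n}" "length ls = n" "set ls \<subseteq> carrier L"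
      "\<forall>i\<in>S. \<exists>p<n. ls ! p \<in> N i"
    have "bracket L (skew_defect L \<sigma> ls # ls') \<in> ?J"
      if ls': "length ls' = n - 1" "set ls' \<subseteq> carrier L" and j: "j < n - 1" "ls' ! j \<in> N m" for ls' j
    proof -
      have "skew_defect L \<sigma> (ls[i := bracket L (ls ! i # ls')]) \<in> ?J" if "i < n" for i
      proof (rule cover_idealI[OF ls(1)])
        note args = derivation_args(3,4)[OF ls(2,3) _ ls']
        show "length (ls[i := bracket L (ls ! i # ls')]) = n"
          "set (ls[i := bracket L (ls ! i # ls')]) \<subseteq> carrier L"
          by (rule derivation_args[OF ls(2,3) that ls'])+
        fix t assume t: "t \<in> insert m S"
        show "\<exists>q<n. ls[i := bracket L (ls ! i # ls')] ! q \<in> N t"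
        proof (cases "t = m")
          case True
          have "bracket L (ls ! i # ls') \<in> N m"
            using ideal_props(6)[OF N args[OF that], of m "Suc j"] j by simp
          then show ?thesis using True ls that by (intro exI[of _ i]) simp
        next
          case False
          then obtain q where q: "q < n" "ls ! q \<in> N t" using t ls by blast
          then have "bracket L (ls ! q # ls') \<in> N t"
            using ideal_props(6)[OF N args, of t q 0] t npos by simp
          then show ?thesis using q ls that by (intro exI[of _ q]) (auto simp: nth_list_update)
        qed
      qed
      then show ?thesis
        unfolding bracket_skew_defect[OF ls(1-3) ls' npos]
        by (intro finsum_in_ideal[OF ideal_cover_ideal]) simp_all
    qed
    moreover have "skew_defect L \<sigma> ls \<in> N i" if "i \<in> S" for i
      using that ls N cover_ideal_in_members[of S N i] cover_idealI[OF ls(1-3), of S N] by blast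
    ultimately show "skew_defect L \<sigma> ls \<in> Z"
      using ls unfolding Z_def by (auto intro: skew_defect_closed)
  qed
  then show ?thesis using any_slot[OF zs] x k by blast
qed

end

section \<open>Kernel pairs of a single homomorphism\<close>

text \<open>The object that \<open>kernel_pair\<close> has at each vertex, for one homomorphism \<open>h\<close>. Working with it first
  keeps the comparison of ideals free of the indexing of fold arrows.\<close>

definition pair_algebra ::
  "('k, 'a nest) leibniz \<Rightarrow> ('a nest \<Rightarrow> 'b) \<Rightarrow> ('k, 'a nest) leibniz" where
  "pair_algebra L h =
    \<lparr>carrier = {Couple x y | x y. x \<in> carrier L \<and> y \<in> carrier L \<and> h x = h y},
     monoid.mult = (\<lambda>z w. Couple (proj0 z \<otimes>\<^bsub>L\<^esub> proj0 w) (proj1 z \<otimes>\<^bsub>L\<^esub> proj1 w)),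
     one = Couple \<one>\<^bsub>L\<^esub> \<one>\<^bsub>L\<^esub>,
     zero = Couple \<zero>\<^bsub>L\<^esub> \<zero>\<^bsub>L\<^esub>,
     add = (\<lambda>z w. Couple (proj0 z \<oplus>\<^bsub>L\<^esub> proj0 w) (proj1 z \<oplus>\<^bsub>L\<^esub> proj1 w)),
     smult = (\<lambda>a z. Couple (a \<odot>\<^bsub>L\<^esub> proj0 z) (a \<odot>\<^bsub>L\<^esub> proj1 z)),
     bracket = (\<lambda>zs. Couple (bracket L (map proj0 zs)) (bracket L (map proj1 zs)))\<rparr>"

lemma pair_algebra_simps [simp]:
  "\<zero>\<^bsub>pair_algebra L h\<^esub> = Couple \<zero>\<^bsub>L\<^esub> \<zero>\<^bsub>L\<^esub>"
  "z \<oplus>\<^bsub>pair_algebra L h\<^esub> w = Couple (proj0 z \<oplus>\<^bsub>L\<^esub> proj0 w) (proj1 z \<oplus>\<^bsub>L\<^esub> proj1 w)"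
  "a \<odot>\<^bsub>pair_algebra L h\<^esub> z = Couple (a \<odot>\<^bsub>L\<^esub> proj0 z) (a \<odot>\<^bsub>L\<^esub> proj1 z)"
  "bracket (pair_algebra L h) zs = Couple (bracket L (map proj0 zs)) (bracket L (map proj1 zs))"
  by (simp_all add: pair_algebra_def)

lemma pair_carrier_iff:
  "z \<in> carrier (pair_algebra L h) \<longleftrightarrow> z = Couple (proj0 z) (proj1 z) \<and>
    proj0 z \<in> carrier L \<and> proj1 z \<in> carrier L \<and> h (proj0 z) = h (proj1 z)"
  by (cases z) (auto simp: pair_algebra_def)

lemma pair_carrierD:
  assumes "z \<in> carrier (pair_algebra L h)"
  shows "proj0 z \<in> carrier L" "proj1 z \<in> carrier L" "h (proj0 z) = h (proj1 z)"
  using assms pair_carrier_iff[of z L h] by blast+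

lemma Couple_carrier [simp]:
  "Couple x y \<in> carrier (pair_algebra L h) \<longleftrightarrow> x \<in> carrier L \<and> y \<in> carrier L \<and> h x = h y"
  by (simp add: pair_carrier_iff)

lemma set_pair_carrier:
  assumes "set zs \<subseteq> carrier (pair_algebra L h)"
  shows "set (map proj0 zs) \<subseteq> carrier L" "set (map proj1 zs) \<subseteq> carrier L"
    "map h (map proj0 zs) = map h (map proj1 zs)"
proof -
  have *: "proj0 z \<in> carrier L \<and> proj1 z \<in> carrier L \<and> h (proj0 z) = h (proj1 z)" if "z \<in> set zs" for z
    using that assms pair_carrierD[of z L h] by blast
  show "set (map proj0 zs) \<subseteq> carrier L" "set (map proj1 zs) \<subseteq> carrier L"
    "map h (map proj0 zs) = map h (map proj1 zs)"
    using * by auto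
qed

locale leibniz_morphism = leibniz_algebra K n L + A: leibniz_algebra K n A
  for K :: "('k, 'c) ring_scheme" and n :: nat and L :: "('k, 'a nest) leibniz"
    and A :: "('k, 'b) leibniz" +
  fixes h :: "'a nest \<Rightarrow> 'b"
  assumes h_hom: "h \<in> leibniz_hom K n L A"
begin

lemma h_facts:
  "x \<in> carrier L \<Longrightarrow> h x \<in> carrier A"
  "\<lbrakk>x \<in> carrier L; y \<in> carrier L\<rbrakk> \<Longrightarrow> h (x \<oplus>\<^bsub>L\<^esub> y) = h x \<oplus>\<^bsub>A\<^esub> h y"
  "\<lbrakk>a \<in> carrier K; x \<in> carrier L\<rbrakk> \<Longrightarrow> h (a \<odot>\<^bsub>L\<^esub> x) = a \<odot>\<^bsub>A\<^esub> h x"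
  "\<lbrakk>length ls = n; set ls \<subseteq> carrier L\<rbrakk> \<Longrightarrow> h (bracket L ls) = bracket A (map h ls)"
  using h_hom unfolding leibniz_hom_def by auto

lemma h_zero [simp]: "h \<zero>\<^bsub>L\<^esub> = \<zero>\<^bsub>A\<^esub>"
  using h_facts(3)[of "\<zero>\<^bsub>K\<^esub>" "\<zero>\<^bsub>L\<^esub>"] h_facts(1)[of "\<zero>\<^bsub>L\<^esub>"] by simp

lemma h_neg: "x \<in> carrier L \<Longrightarrow> h (\<ominus>\<^bsub>L\<^esub> x) = \<ominus>\<^bsub>A\<^esub> h x"
  using h_facts(3)[of "\<ominus>\<^bsub>K\<^esub> \<one>\<^bsub>K\<^esub>" x] h_facts(1)[of x]
  by (simp add: smult_l_minus A.smult_l_minus)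

lemma h_eq_iff:
  assumes "x \<in> carrier L" "y \<in> carrier L"
  shows "h x = h y \<longleftrightarrow> h (y \<ominus>\<^bsub>L\<^esub> x) = \<zero>\<^bsub>A\<^esub>"
proof -
  have c: "h x \<in> carrier A" "h y \<in> carrier A" using assms h_facts(1) by auto
  then have "h y = (h y \<oplus>\<^bsub>A\<^esub> \<ominus>\<^bsub>A\<^esub> h x) \<oplus>\<^bsub>A\<^esub> h x" by (simp add: A.M.add.m_assoc A.M.l_neg)
  moreover have "h (y \<ominus>\<^bsub>L\<^esub> x) = h y \<oplus>\<^bsub>A\<^esub> \<ominus>\<^bsub>A\<^esub> h x"
    using assms by (simp add: a_minus_def h_facts h_neg)
  ultimately show ?thesis using c by (metis A.M.l_zero A.M.r_neg)
qed

lemma ideal_kernel: "leibniz_ideal K n L {x \<in> carrier L. h x = \<zero>\<^bsub>A\<^esub>}"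
proof (rule leibniz_idealI)
  fix ls i assume a: "length ls = n" "set ls \<subseteq> carrier L" "i < n" "ls ! i \<in> {x \<in> carrier L. h x = \<zero>\<^bsub>A\<^esub>}"
  then have "bracket A (map h ls) \<in> {\<zero>\<^bsub>A\<^esub>}"
    by (intro A.ideal_props(6)[OF A.ideal_zero, of _ i]) (auto simp: h_facts(1))
  then show "bracket L ls \<in> {x \<in> carrier L. h x = \<zero>\<^bsub>A\<^esub>}"
    using a by (simp add: h_facts(4) bracket_closed)
qed (auto simp: h_facts)

lemma pair_abelian_group: "abelian_group (pair_algebra L h)"
proof (rule abelian_groupI)
  fix z assume z: "z \<in> carrier (pair_algebra L h)"
  then show "\<exists>w\<in>carrier (pair_algebra L h). w \<oplus>\<^bsub>pair_algebra L h\<^esub> z = \<zero>\<^bsub>pair_algebra L h\<^esub>"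
    by (intro bexI[of _ "Couple (\<ominus>\<^bsub>L\<^esub> proj0 z) (\<ominus>\<^bsub>L\<^esub> proj1 z)"])
      (auto simp: pair_carrier_iff h_neg M.l_neg)
qed (auto simp: pair_carrier_iff h_facts M.a_ac)

lemma pair_module: "module K (pair_algebra L h)"
proof (rule moduleI)
  show "cring K" by (rule R.is_cring)
qed (use pair_abelian_group in \<open>auto simp: pair_carrier_iff h_facts smult_l_distr smult_r_distr smult_assoc1\<close>)

text \<open>Needed to reduce the Leibniz identity, the only axiom that involves a sum, to the components.\<close>

lemma pair_finsum:
  assumes "finite I" "F \<in> I \<rightarrow> carrier (pair_algebra L h)"
  shows "(\<Oplus>\<^bsub>pair_algebra L h\<^esub>i\<in>I. F i) = Couple (\<Oplus>\<^bsub>L\<^esub>i\<in>I. proj0 (F i)) (\<Oplus>\<^bsub>L\<^esub>i\<in>I. proj1 (F i))"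
proof -
  interpret P: abelian_group "pair_algebra L h" by (rule pair_abelian_group)
  have pr: "proj0 (F i) \<in> carrier L" "proj1 (F i) \<in> carrier L" if "i \<in> I" for i
    using that assms(2) pair_carrierD[of "F i" L h] by blast+
  show ?thesis
    using assms pr
  proof (induction I)
    case (insert i I)
    then show ?case by (simp add: Pi_def)
  qed simp
qed

lemma pair_bracket_closed:
  assumes "length zs = n" "set zs \<subseteq> carrier (pair_algebra L h)"
  shows "bracket (pair_algebra L h) zs \<in> carrier (pair_algebra L h)"
  using assms set_pair_carrier[OF assms(2)]
  by (auto simp: bracket_closed h_facts(4) simp del: map_map set_map)

lemma pair_leibniz: "leibniz_algebra K n (pair_algebra L h)"
proof -
  interpret P: module K "pair_algebra L h" by (rule pair_module)
  show ?thesis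
  proof (intro leibniz_algebra.intro leibniz_algebra_axioms.intro)
    show "module K (pair_algebra L h)" by (rule pair_module)
    show "field K" by (rule K.field_axioms)
    show "bracket (pair_algebra L h) zs \<in> carrier (pair_algebra L h)"
      if "length zs = n" "set zs \<subseteq> carrier (pair_algebra L h)" for zs
      by (rule pair_bracket_closed[OF that])
  next
    fix zs i and z w
    assume zs: "length zs = n" "set zs \<subseteq> carrier (pair_algebra L h)" "i < n"
      and "z \<in> carrier (pair_algebra L h)" "w \<in> carrier (pair_algebra L h)"
    then have "proj0 z \<in> carrier L" "proj1 z \<in> carrier L" "proj0 w \<in> carrier L" "proj1 w \<in> carrier L"
      by (blast dest: pair_carrierD)+
    then show "bracket (pair_algebra L h) (zs[i := z \<oplus>\<^bsub>pair_algebra L h\<^esub> w])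
      = bracket (pair_algebra L h) (zs[i := z]) \<oplus>\<^bsub>pair_algebra L h\<^esub> bracket (pair_algebra L h) (zs[i := w])"
      using zs set_pair_carrier[OF zs(2)] by (simp add: map_update bracket_add del: set_map)
  next
    fix zs i a z
    assume zs: "length zs = n" "set zs \<subseteq> carrier (pair_algebra L h)" "i < n"
      and "a \<in> carrier K" "z \<in> carrier (pair_algebra L h)"
    then have "a \<in> carrier K" "proj0 z \<in> carrier L" "proj1 z \<in> carrier L"
      by (blast dest: pair_carrierD)+
    then show "bracket (pair_algebra L h) (zs[i := a \<odot>\<^bsub>pair_algebra L h\<^esub> z])
      = a \<odot>\<^bsub>pair_algebra L h\<^esub> bracket (pair_algebra L h) (zs[i := z])"
      using zs set_pair_carrier[OF zs(2)] by (simp add: map_update bracket_smult del: set_map)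
  next
    fix zs zs'
    assume zs: "length zs = n" "set zs \<subseteq> carrier (pair_algebra L h)"
      and zs': "length zs' = n - 1" "set zs' \<subseteq> carrier (pair_algebra L h)"
    define F where "F i = zs[i := bracket (pair_algebra L h) (zs ! i # zs')]" for i
    have F: "bracket (pair_algebra L h) (F i) \<in> carrier (pair_algebra L h)" if "i < n" for i
    proof (rule pair_bracket_closed)
      have "zs ! i \<in> carrier (pair_algebra L h)" using that zs nth_mem[of i zs] by blast
      then have "bracket (pair_algebra L h) (zs ! i # zs') \<in> carrier (pair_algebra L h)"
        using zs' that by (intro pair_bracket_closed) auto
      then show "set (F i) \<subseteq> carrier (pair_algebra L h)"
        unfolding F_def using zs set_update_subset_insert[of zs i] by blast
    qed (simp add: F_def zs)
    have proj: "(\<Oplus>\<^bsub>L\<^esub>i\<in>{..<n}. \<pi> (bracket (pair_algebra L h) (F i)))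
        = bracket L (bracket L (map \<pi> zs) # map \<pi> zs')"
      if \<pi>: "\<pi> = proj0 \<or> \<pi> = proj1" for \<pi>
    proof -
      have c: "set (map \<pi> zs) \<subseteq> carrier L" "set (map \<pi> zs') \<subseteq> carrier L"
        using \<pi> set_pair_carrier(1,2)[OF zs(2)] set_pair_carrier(1,2)[OF zs'(2)] by metis+
      have "bracket L (bracket L (map \<pi> zs) # map \<pi> zs') =
          (\<Oplus>\<^bsub>L\<^esub>i\<in>{..<n}. bracket L ((map \<pi> zs)[i := bracket L (map \<pi> zs ! i # map \<pi> zs')]))"
        using zs(1) zs'(1) by (intro leibniz_identity c) simp_all
      also have "\<dots> = (\<Oplus>\<^bsub>L\<^esub>i\<in>{..<n}. \<pi> (bracket (pair_algebra L h) (F i)))"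
      proof (rule M.finsum_cong')
        show "bracket L ((map \<pi> zs)[i := bracket L (map \<pi> zs ! i # map \<pi> zs')])
            = \<pi> (bracket (pair_algebra L h) (F i))" if "i \<in> {..<n}" for i
          using \<pi> that zs(1) by (auto simp: F_def map_update)
        show "(\<lambda>i. \<pi> (bracket (pair_algebra L h) (F i))) \<in> {..<n} \<rightarrow> carrier L"
          using \<pi> pair_carrierD(1,2)[OF F] by auto
      qed simp
      finally show ?thesis by simp
    qed
    have "(\<Oplus>\<^bsub>pair_algebra L h\<^esub>i\<in>{..<n}. bracket (pair_algebra L h) (F i))
        = bracket (pair_algebra L h) (bracket (pair_algebra L h) zs # zs')"
      using proj[of proj0] proj[of proj1] F by (subst pair_finsum) auto
    then show "bracket (pair_algebra L h) (bracket (pair_algebra L h) zs # zs') =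
        (\<Oplus>\<^bsub>pair_algebra L h\<^esub>i\<in>{..<n}.
          bracket (pair_algebra L h) (zs[i := bracket (pair_algebra L h) (zs ! i # zs')]))"
      by (simp add: F_def)
  qed
qed

sublocale P: leibniz_algebra K n "pair_algebra L h" by (rule pair_leibniz)

lemma pair_skew_defect:
  assumes "\<sigma> permutes {..<n}" "length zs = n" "set zs \<subseteq> carrier (pair_algebra L h)"
  shows "skew_defect (pair_algebra L h) \<sigma> zs
    = Couple (skew_defect L \<sigma> (map proj0 zs)) (skew_defect L \<sigma> (map proj1 zs))"
  using assms set_pair_carrier[OF assms(3)]
  by (simp add: P.skew_defect_eq skew_defect_eq permute_list_map del: set_map map_map)

definition pair_family :: "(nat \<Rightarrow> 'a nest set) \<Rightarrow> nat \<Rightarrow> 'a nest set" where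
  "pair_family N i = {z \<in> carrier (pair_algebra L h). proj0 z \<in> N i \<and> proj1 z \<in> N i}"

text \<open>The generators force a stronger claim, \<open>x \<in> J\<^sub>S\<close> and \<open>y - x \<in> J\<close> for the first and second component
  \<open>x\<close> and \<open>y\<close>, where \<open>J\<^sub>S\<close> and \<open>J\<close> belong to \<open>S\<close> and \<open>S \<union> {m}\<close>: without \<open>x \<in> J\<^sub>S\<close> the property
  is not closed under brackets. Indeed, when \<open>(x, y)\<close> is bracketed with other
  pairs, the difference of the two components telescopes into brackets which contain \<open>y - x\<close> itself,
  or else \<open>x\<close> or \<open>y\<close> beside a difference of another pair, which lies in the kernel \<open>N\<^sub>m\<close> of \<open>h\<close>.\<close>

lemma cover_ideal_of_pairs:
  assumes N: "\<And>i. i \<in> S \<Longrightarrow> leibniz_ideal K n L (N i)"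
    and ker: "N m = {x \<in> carrier L. h x = \<zero>\<^bsub>A\<^esub>}"
    and z: "z \<in> cover_ideal K n (pair_algebra L h) (pair_family N) S"
  shows "proj1 z \<ominus>\<^bsub>L\<^esub> proj0 z \<in> cover_ideal K n L N (insert m S)"
proof -
  let ?P = "pair_algebra L h"
  let ?JS = "cover_ideal K n L N S" and ?J = "cover_ideal K n L N (insert m S)"
  note J0 = ideal_props[OF ideal_cover_ideal[of N S]]
  note J = ideal_props[OF ideal_cover_ideal[of N "insert m S"]]
  have J_J0: "?J \<subseteq> ?JS" by (rule cover_ideal_antimono) blast
  have Nm: "leibniz_ideal K n L (N i)" if "i \<in> insert m S" for i
    using that N ker ideal_kernel by auto
  have diff: "proj1 (zs ! j) \<ominus>\<^bsub>L\<^esub> proj0 (zs ! j) \<in> N m"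
    if "set zs \<subseteq> carrier ?P" "j < length zs" for zs j
  proof -
    have "zs ! j \<in> carrier ?P" using that nth_mem by blast
    note pair_carrierD[OF this]
    then show ?thesis using h_eq_iff[of "proj0 (zs ! j)" "proj1 (zs ! j)"]
      by (simp add: ker)
  qed
  define D where "D = {z \<in> carrier ?P. proj0 z \<in> ?JS \<and> proj1 z \<ominus>\<^bsub>L\<^esub> proj0 z \<in> ?J}"
  have "leibniz_ideal K n ?P D"
  proof (rule P.leibniz_idealI)
    show "D \<subseteq> carrier ?P" unfolding D_def by blast
    show "\<zero>\<^bsub>?P\<^esub> \<in> D" using J0(2) J(2) J(4)[OF J(2) J(2)] by (simp add: D_def)
    show "z \<oplus>\<^bsub>?P\<^esub> w \<in> D" if "z \<in> D" "w \<in> D" for z w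
    proof -
      have c: "proj0 z \<in> carrier L" "proj1 z \<in> carrier L" "proj0 w \<in> carrier L" "proj1 w \<in> carrier L"
        using that pair_carrierD[of z L h] pair_carrierD[of w L h] unfolding D_def by blast+
      have "proj1 (z \<oplus>\<^bsub>?P\<^esub> w) \<ominus>\<^bsub>L\<^esub> proj0 (z \<oplus>\<^bsub>?P\<^esub> w)
          = (proj1 z \<ominus>\<^bsub>L\<^esub> proj0 z) \<oplus>\<^bsub>L\<^esub> (proj1 w \<ominus>\<^bsub>L\<^esub> proj0 w)"
        using c by (simp add: a_minus_def M.minus_add M.a_ac)
      then show ?thesis
        using that J0(3) J(3) P.M.a_closed[of z w] by (simp add: D_def del: Couple_carrier)
    qed
    show "a \<odot>\<^bsub>?P\<^esub> z \<in> D" if "a \<in> carrier K" "z \<in> D" for a z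
    proof -
      have c: "proj0 z \<in> carrier L" "proj1 z \<in> carrier L"
        using that pair_carrierD[of z L h] unfolding D_def by blast+
      have "proj1 (a \<odot>\<^bsub>?P\<^esub> z) \<ominus>\<^bsub>L\<^esub> proj0 (a \<odot>\<^bsub>?P\<^esub> z) = a \<odot>\<^bsub>L\<^esub> (proj1 z \<ominus>\<^bsub>L\<^esub> proj0 z)"
        using c that(1) by (simp add: a_minus_def smult_r_distr smult_r_minus)
      then show ?thesis
        using that J0(5) J(5) P.smult_closed[of a z] by (simp add: D_def del: Couple_carrier)
    qed
    fix zs p assume zs: "length zs = n" "set zs \<subseteq> carrier ?P" "p < n" "zs ! p \<in> D"
    note c = set_pair_carrier[OF zs(2)]
    have p0: "proj0 (zs ! p) \<in> ?JS" and pd: "proj1 (zs ! p) \<ominus>\<^bsub>L\<^esub> proj0 (zs ! p) \<in> ?J"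
      using zs(4) by (simp_all add: D_def)
    have pc: "proj0 (zs ! p) \<in> carrier L" "proj1 (zs ! p) \<in> carrier L"
      using zs(4) pair_carrierD[of "zs ! p" L h] unfolding D_def by blast+
    \<comment> \<open>The telescoping below may leave either component in slot \<open>p\<close>.\<close>
    have p1: "proj1 (zs ! p) \<in> ?JS"
    proof -
      have "(proj1 (zs ! p) \<ominus>\<^bsub>L\<^esub> proj0 (zs ! p)) \<oplus>\<^bsub>L\<^esub> proj0 (zs ! p) \<in> ?JS"
        by (rule J0(3)[OF subsetD[OF J_J0 pd] p0])
      then show ?thesis using pc by (simp add: a_minus_def M.add.m_assoc M.l_neg)
    qed
    have "bracket L (map proj1 zs) \<ominus>\<^bsub>L\<^esub> bracket L (map proj0 zs) \<in> ?J"
    proof (rule slotwise_difference[OF ideal_cover_ideal bracket_closed bracket_add])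
      fix ws j assume ws: "length ws = n" "set ws \<subseteq> carrier L" "j < n"
        and wj: "ws ! j = map proj1 zs ! j \<ominus>\<^bsub>L\<^esub> map proj0 zs ! j"
        and wi: "\<forall>i<n. i \<noteq> j \<longrightarrow> ws ! i = map proj0 zs ! i \<or> ws ! i = map proj1 zs ! i"
      show "bracket L ws \<in> ?J"
      proof (cases "j = p")
        case True
        then show ?thesis using J(6)[OF ws] wj pd zs by simp
      next
        case False
        then have "ws ! p \<in> ?JS" using wi zs p0 p1 by auto
        moreover have "ws ! j \<in> N m" using wj diff[OF zs(2)] ws(3) zs(1) by simp
        ultimately show ?thesis
          using False by (intro cover_ideal_absorbs[where N = N and p = p and j = j, OF Nm ws(1,2) zs(3) ws(3)]) auto
      qed
    qed (use zs(1) c in simp_all)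
    moreover have "bracket L (map proj0 zs) \<in> ?JS"
      using J0(6)[OF _ c(1) zs(3)] zs p0 by simp
    ultimately show "bracket ?P zs \<in> D"
      using P.bracket_closed[OF zs(1,2)] by (simp add: D_def del: Couple_carrier)
  qed
  then have "cover_ideal K n ?P (pair_family N) S \<subseteq> D"
  proof (rule P.cover_ideal_subset)
    fix \<sigma> zs assume zs: "\<sigma> permutes {..<n}" "length zs = n" "set zs \<subseteq> carrier ?P"
      and cover: "\<forall>i\<in>S. \<exists>p<n. zs ! p \<in> pair_family N i"
    note c = set_pair_carrier[OF zs(3)]
    have "skew_defect L \<sigma> (map proj0 zs) \<in> ?JS"
    proof (rule cover_idealI)
      fix i assume "i \<in> S"
      then obtain p where p: "p < n" "zs ! p \<in> pair_family N i" using cover by blast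
      then show "\<exists>p<n. map proj0 zs ! p \<in> N i"
        using zs by (intro exI[of _ p]) (simp add: pair_family_def)
    qed (use zs c in simp_all)
    moreover have "skew_defect L \<sigma> (map proj1 zs) \<ominus>\<^bsub>L\<^esub> skew_defect L \<sigma> (map proj0 zs) \<in> ?J"
    proof (rule slotwise_difference[OF ideal_cover_ideal skew_defect_closed[OF zs(1)]
          skew_defect_add[OF zs(1)]])
      fix ws j assume ws: "length ws = n" "set ws \<subseteq> carrier L" "j < n"
        and wj: "ws ! j = map proj1 zs ! j \<ominus>\<^bsub>L\<^esub> map proj0 zs ! j"
        and wi: "\<forall>i<n. i \<noteq> j \<longrightarrow> ws ! i = map proj0 zs ! i \<or> ws ! i = map proj1 zs ! i"
      show "skew_defect L \<sigma> ws \<in> ?J"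
      proof (rule cover_idealI[OF zs(1) ws(1,2)])
        fix i assume i: "i \<in> insert m S"
        show "\<exists>p<n. ws ! p \<in> N i"
        proof (cases "i = m")
          case True
          then show ?thesis using wj diff[OF zs(3)] ws(3) zs(2) by auto
        next
          case False
          then obtain p where p: "p < n" "zs ! p \<in> pair_family N i" using cover i by blast
          then have in_N: "proj0 (zs ! p) \<in> N i" "proj1 (zs ! p) \<in> N i"
            by (simp_all add: pair_family_def)
          then have "proj1 (zs ! p) \<ominus>\<^bsub>L\<^esub> proj0 (zs ! p) \<in> N i"
            using ideal_props(4)[OF Nm[OF i]] by blast
          then have "ws ! p \<in> N i" using wi wj in_N p(1) zs(2) by (cases "p = j") auto
          then show ?thesis using p by blast
        qed
      qed
    qed (use zs(2) c in simp_all)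
    ultimately show "skew_defect ?P \<sigma> zs \<in> D"
      using P.skew_defect_closed[OF zs] by (simp add: D_def pair_skew_defect[OF zs] del: Couple_carrier)
  qed
  then show ?thesis using z unfolding D_def by blast
qed

text \<open>A tuple \<open>ls\<close> in \<open>L\<close> with \<open>l\<^sub>p\<close> in the kernel of \<open>h\<close> lifts to pairs: \<open>(0, l\<^sub>p)\<close> in slot \<open>p\<close> and
  diagonal elements elsewhere. The first components then have bracket and skew defect zero, the second
  components are \<open>ls\<close>, and a slot whose entry is in \<open>N\<^sub>i\<close> becomes a pair with both components in \<open>N\<^sub>i\<close>.\<close>

lemma cover_ideal_to_pairs:
  assumes N: "\<And>i. i \<in> S \<Longrightarrow> leibniz_ideal K n L (N i)"
    and ker: "N m = {x \<in> carrier L. h x = \<zero>\<^bsub>A\<^esub>}"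
    and k: "k \<in> cover_ideal K n L N (insert m S)"
  shows "Couple \<zero>\<^bsub>L\<^esub> k \<in> cover_ideal K n (pair_algebra L h) (pair_family N) S"
proof -
  let ?P = "pair_algebra L h" and ?J = "cover_ideal K n (pair_algebra L h) (pair_family N) S"
  note J = P.ideal_props[OF P.ideal_cover_ideal[of "pair_family N" S]]
  define D where "D = {k \<in> carrier L. Couple \<zero>\<^bsub>L\<^esub> k \<in> ?J}"
  define lift where "lift ls p = (map (\<lambda>x. Couple x x) ls)[p := Couple \<zero>\<^bsub>L\<^esub> (ls ! p)]" for ls p
  have lift: "length (lift ls p) = n" "set (lift ls p) \<subseteq> carrier ?P"
      "map proj0 (lift ls p) = ls[p := \<zero>\<^bsub>L\<^esub>]" "map proj1 (lift ls p) = ls"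
    if "length ls = n" "set ls \<subseteq> carrier L" "p < n" "h (ls ! p) = \<zero>\<^bsub>A\<^esub>" for ls p
  proof -
    have "set (map (\<lambda>x. Couple x x) ls) \<subseteq> carrier ?P" using that by auto
    moreover have "Couple \<zero>\<^bsub>L\<^esub> (ls ! p) \<in> carrier ?P" using that nth_carrier by simp
    ultimately show "set (lift ls p) \<subseteq> carrier ?P"
      unfolding lift_def by (rule P.set_update_carrier)
  qed (use that in \<open>simp_all add: lift_def map_update comp_def\<close>)
  have zeroed: "bracket L (ls[p := \<zero>\<^bsub>L\<^esub>]) = \<zero>\<^bsub>L\<^esub>"
      "\<sigma> permutes {..<n} \<Longrightarrow> skew_defect L \<sigma> (ls[p := \<zero>\<^bsub>L\<^esub>]) = \<zero>\<^bsub>L\<^esub>"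
    if "length ls = n" "set ls \<subseteq> carrier L" "p < n" for ls p \<sigma>
    using ideal_props(6)[OF ideal_zero, of "ls[p := \<zero>\<^bsub>L\<^esub>]" p]
      skew_defect_in_ideal[OF ideal_zero, of \<sigma> "ls[p := \<zero>\<^bsub>L\<^esub>]" p] that
    by (simp_all add: set_update_carrier)
  have "leibniz_ideal K n L D"
  proof (rule leibniz_idealI)
    show "D \<subseteq> carrier L" unfolding D_def by blast
    show "\<zero>\<^bsub>L\<^esub> \<in> D" using J(2) by (simp add: D_def)
    show "x \<oplus>\<^bsub>L\<^esub> y \<in> D" if "x \<in> D" "y \<in> D" for x y
      using that J(3)[of "Couple \<zero>\<^bsub>L\<^esub> x" "Couple \<zero>\<^bsub>L\<^esub> y"] by (simp add: D_def)
    show "a \<odot>\<^bsub>L\<^esub> x \<in> D" if "a \<in> carrier K" "x \<in> D" for a x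
      using that J(5)[of a "Couple \<zero>\<^bsub>L\<^esub> x"] by (simp add: D_def)
    fix ls p assume ls: "length ls = n" "set ls \<subseteq> carrier L" "p < n" "ls ! p \<in> D"
    then have "Couple \<zero>\<^bsub>L\<^esub> (ls ! p) \<in> ?J" by (simp add: D_def)
    then have "h (ls ! p) = \<zero>\<^bsub>A\<^esub>" using J(1) Couple_carrier[of "\<zero>\<^bsub>L\<^esub>" "ls ! p" L h] by auto
    note l = lift[OF ls(1-3) this]
    have "lift ls p ! p \<in> ?J" using ls \<open>Couple \<zero>\<^bsub>L\<^esub> (ls ! p) \<in> ?J\<close> by (simp add: lift_def)
    then have "bracket ?P (lift ls p) \<in> ?J" using J(6)[OF l(1,2) ls(3)] by blast
    then show "bracket L ls \<in> D"
      using ls l zeroed by (simp add: D_def bracket_closed)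
  qed
  then have "cover_ideal K n L N (insert m S) \<subseteq> D"
  proof (rule cover_ideal_subset)
    fix \<sigma> ls assume ls: "\<sigma> permutes {..<n}" "length ls = n" "set ls \<subseteq> carrier L"
      and cover: "\<forall>i\<in>insert m S. \<exists>p<n. ls ! p \<in> N i"
    then obtain q where q: "q < n" "ls ! q \<in> N m" by blast
    then have "h (ls ! q) = \<zero>\<^bsub>A\<^esub>" by (simp add: ker)
    note l = lift[OF ls(2,3) q(1) this]
    have "skew_defect ?P \<sigma> (lift ls q) \<in> ?J"
    proof (rule P.cover_idealI[OF ls(1) l(1,2)])
      fix i assume i: "i \<in> S"
      then obtain p where p: "p < n" "ls ! p \<in> N i" using cover by blast
      have "lift ls q ! p \<in> carrier ?P" using P.nth_carrier l(1,2) p(1) by simp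
      then have "lift ls q ! p \<in> pair_family N i"
        using p q ls(2) ideal_props(2)[OF N[OF i]]
        by (auto simp: pair_family_def lift_def nth_list_update)
      then show "\<exists>p<n. lift ls q ! p \<in> pair_family N i" using p by blast
    qed
    then show "skew_defect L \<sigma> ls \<in> D"
      using pair_skew_defect[OF ls(1) l(1,2)] l(3,4) zeroed(2)[OF ls(2,3) q(1) ls(1)]
      by (simp add: D_def skew_defect_closed[OF ls])
  qed
  then show ?thesis using k unfolding D_def by blast
qed

end

section \<open>Kernel pairs of fold arrows\<close>

lemma obj_kernel_pair: "obj (kernel_pair m f) I = pair_algebra (obj f I) (mor f I (I \<union> {m}))"
  by (simp add: kernel_pair_def pair_algebra_def)

lemma mor_kernel_pair: "mor (kernel_pair m f) I J z = Couple (mor f I J (proj0 z)) (mor f I J (proj1 z))"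
  by (simp add: kernel_pair_def)

lemma fold_arrow_morphism:
  fixes f :: "('k, 'a nest) fold_arrow"
  assumes "is_fold_arrow K n m f" "I \<subseteq> J" "J \<subseteq> {1..m}"
  shows "leibniz_morphism K n (obj f I) (obj f J) (mor f I J)"
proof -
  have "I \<subseteq> {1..m}" using assms(2,3) by (rule subset_trans)
  then have "leibniz_algebra K n (obj f I)" "leibniz_algebra K n (obj f J)"
      "mor f I J \<in> leibniz_hom K n (obj f I) (obj f J)"
    using assms by (simp_all add: is_fold_arrow_def)
  then show ?thesis
    by (intro leibniz_morphism.intro leibniz_morphism_axioms.intro)
qed

lemma kernel_pair_fold_arrow:
  assumes f: "is_fold_arrow K n (Suc m) f"
  shows "is_fold_arrow K n m (kernel_pair (Suc m) f)"
proof -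
  let ?R = "kernel_pair (Suc m) f"
  have mor: "leibniz_morphism K n (obj f I) (obj f J) (mor f I J)"
    if "I \<subseteq> J" "J \<subseteq> {1..Suc m}" for I J
    by (rule fold_arrow_morphism[OF f that])
  have pair: "leibniz_morphism K n (obj f I) (obj f (I \<union> {Suc m})) (mor f I (I \<union> {Suc m}))"
    if "I \<subseteq> {1..m}" for I
    using that by (intro mor) auto
  have comp: "mor f J H (mor f I J x) = mor f I H x"
    if "I \<subseteq> J" "J \<subseteq> H" "H \<subseteq> {1..Suc m}" "x \<in> carrier (obj f I)" for I J H x
    using f that by (simp add: is_fold_arrow_def)
  have ident: "mor f I I x = x" if "I \<subseteq> {1..Suc m}" "x \<in> carrier (obj f I)" for I x
    using f that by (simp add: is_fold_arrow_def)
  have collapse: "Couple (proj0 z) (proj1 z) = z" if "z \<in> carrier (obj ?R I)" for z I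
    using that by (cases z) (auto simp: obj_kernel_pair pair_carrier_iff)
  have carr: "proj0 z \<in> carrier (obj f I)" "proj1 z \<in> carrier (obj f I)"
      "mor f I (I \<union> {Suc m}) (proj0 z) = mor f I (I \<union> {Suc m}) (proj1 z)"
    if "z \<in> carrier (obj ?R I)" for z I
    by (rule pair_carrierD[OF that[unfolded obj_kernel_pair]])+
  show ?thesis unfolding is_fold_arrow_def
  proof (intro conjI allI impI ballI)
    show "leibniz_algebra K n (obj ?R I)" if "I \<subseteq> {1..m}" for I
      unfolding obj_kernel_pair by (rule leibniz_morphism.pair_leibniz[OF pair[OF that]])
  next
    fix I J assume IJ: "I \<subseteq> J \<and> J \<subseteq> {1..m}"
    then have IJ': "I \<subseteq> J" "J \<subseteq> {1..Suc m}" "J \<union> {Suc m} \<subseteq> {1..Suc m}" "I \<union> {Suc m} \<subseteq> J \<union> {Suc m}"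
      by auto
    interpret h: leibniz_morphism K n "obj f I" "obj f J" "mor f I J" by (rule mor[OF IJ'(1,2)])
    have closed: "mor ?R I J z \<in> carrier (obj ?R J)" if z: "z \<in> carrier (obj ?R I)" for z
    proof -
      note c = carr[OF z]
      have "mor f J (J \<union> {Suc m}) (mor f I J x) = mor f (I \<union> {Suc m}) (J \<union> {Suc m}) (mor f I (I \<union> {Suc m}) x)"
        if "x \<in> carrier (obj f I)" for x
      proof -
        have "mor f J (J \<union> {Suc m}) (mor f I J x) = mor f I (J \<union> {Suc m}) x"
          using IJ' that by (intro comp) auto
        also have "\<dots> = mor f (I \<union> {Suc m}) (J \<union> {Suc m}) (mor f I (I \<union> {Suc m}) x)"
          using IJ' that by (intro comp[symmetric]) auto
        finally show ?thesis .
      qed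
      then show ?thesis
        using c h.h_facts(1) by (simp add: mor_kernel_pair obj_kernel_pair)
    qed
    have br: "mor ?R I J (bracket (obj ?R I) zs) = bracket (obj ?R J) (map (mor ?R I J) zs)"
      if zs: "length zs = n" "set zs \<subseteq> carrier (obj ?R I)" for zs
    proof -
      note c = set_pair_carrier[OF zs(2)[unfolded obj_kernel_pair]]
      have "mor f I J (bracket (obj f I) (map \<pi> zs)) = bracket (obj f J) (map (mor f I J \<circ> \<pi>) zs)"
        if "\<pi> = proj0 \<or> \<pi> = proj1" for \<pi>
        using that zs(1) c(1,2) h.h_facts(4)[of "map \<pi> zs"] by (auto simp del: set_map)
      then show ?thesis
        by (simp add: mor_kernel_pair obj_kernel_pair comp_def)
    qed
    show "mor ?R I J \<in> leibniz_hom K n (obj ?R I) (obj ?R J)"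
      unfolding leibniz_hom_def
    proof (intro CollectI conjI ballI allI impI funcsetI)
      show "mor ?R I J z \<in> carrier (obj ?R J)" if "z \<in> carrier (obj ?R I)" for z
        by (rule closed[OF that])
      show "mor ?R I J (z \<oplus>\<^bsub>obj ?R I\<^esub> w) = mor ?R I J z \<oplus>\<^bsub>obj ?R J\<^esub> mor ?R I J w"
        if "z \<in> carrier (obj ?R I)" "w \<in> carrier (obj ?R I)" for z w
        using carr(1,2)[OF that(1)] carr(1,2)[OF that(2)]
        by (simp add: mor_kernel_pair obj_kernel_pair h.h_facts(2))
      show "mor ?R I J (a \<odot>\<^bsub>obj ?R I\<^esub> z) = a \<odot>\<^bsub>obj ?R J\<^esub> mor ?R I J z"
        if "a \<in> carrier K" "z \<in> carrier (obj ?R I)" for a z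
        using that(1) carr(1,2)[OF that(2)]
        by (simp add: mor_kernel_pair obj_kernel_pair h.h_facts(3))
      show "mor ?R I J (bracket (obj ?R I) zs) = bracket (obj ?R J) (map (mor ?R I J) zs)"
        if "length zs = n \<and> set zs \<subseteq> carrier (obj ?R I)" for zs
        using br that by blast
    qed
  next
    fix I z assume I: "I \<subseteq> {1..m}" "z \<in> carrier (obj ?R I)"
    then have "I \<subseteq> {1..Suc m}" by auto
    then show "mor ?R I I z = z"
      using carr(1,2)[OF I(2)] collapse[OF I(2)] by (simp only: mor_kernel_pair ident)
  next
    fix I J H z assume "I \<subseteq> J \<and> J \<subseteq> H \<and> H \<subseteq> {1..m}" "z \<in> carrier (obj ?R I)"
    moreover from this have "H \<subseteq> {1..Suc m}" by auto
    ultimately show "mor ?R J H (mor ?R I J z) = mor ?R I H z"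
      using carr(1,2)[of z I] by (simp add: mor_kernel_pair comp)
  qed
qed

lemma kernel_at_eq: "kernel_at f i = {x \<in> carrier (obj f {}). mor f {} {i} x = \<zero>\<^bsub>obj f {i}\<^esub>}"
  by (simp add: kernel_at_def a_kernel_def')

lemma kernel_at_ideal:
  fixes f :: "('k, 'a nest) fold_arrow"
  assumes "is_fold_arrow K n m f" "i \<in> {1..m}"
  shows "leibniz_ideal K n (obj f {}) (kernel_at f i)"
proof -
  interpret leibniz_morphism K n "obj f {}" "obj f {i}" "mor f {} {i}"
    using assms by (intro fold_arrow_morphism) auto
  show ?thesis unfolding kernel_at_eq by (rule ideal_kernel)
qed

text \<open>The comparison applied to \<open>mor f {} {Suc m}\<close>. It fits because the kernels of
  the kernel pair are formed componentwise, so that they are the families \<open>pair_family (kernel_at f)\<close>.\<close>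

lemma cover_ideal_kernel_pair:
  assumes f: "is_fold_arrow K n (Suc m) f"
  shows "k \<in> cover_ideal K n (obj f {}) (kernel_at f) {1..Suc m} \<Longrightarrow>
      Couple \<zero>\<^bsub>obj f {}\<^esub> k
        \<in> cover_ideal K n (obj (kernel_pair (Suc m) f) {}) (kernel_at (kernel_pair (Suc m) f)) {1..m}"
    and "z \<in> cover_ideal K n (obj (kernel_pair (Suc m) f) {}) (kernel_at (kernel_pair (Suc m) f)) {1..m} \<Longrightarrow>
      proj1 z \<ominus>\<^bsub>obj f {}\<^esub> proj0 z \<in> cover_ideal K n (obj f {}) (kernel_at f) {1..Suc m}"
proof -
  interpret leibniz_morphism K n "obj f {}" "obj f {Suc m}" "mor f {} {Suc m}"
    using f by (intro fold_arrow_morphism) auto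
  have N: "leibniz_ideal K n (obj f {}) (kernel_at f i)" if "i \<in> {1..m}" for i
    using that by (intro kernel_at_ideal[OF f]) auto
  have S: "insert (Suc m) {1..m} = {1..Suc m}" by auto
  have ideal: "cover_ideal K n (obj (kernel_pair (Suc m) f) {}) (kernel_at (kernel_pair (Suc m) f)) {1..m}
      = cover_ideal K n (pair_algebra (obj f {}) (mor f {} {Suc m})) (pair_family (kernel_at f)) {1..m}"
    unfolding obj_kernel_pair Un_insert_right Un_empty_left
  proof (rule cover_ideal_cong)
    fix i assume "i \<in> {1..m}"
    show "kernel_at (kernel_pair (Suc m) f) i = pair_family (kernel_at f) i"
      by (auto simp: kernel_at_eq pair_family_def obj_kernel_pair mor_kernel_pair pair_carrier_iff)
  qed
  show "Couple \<zero>\<^bsub>obj f {}\<^esub> k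
        \<in> cover_ideal K n (obj (kernel_pair (Suc m) f) {}) (kernel_at (kernel_pair (Suc m) f)) {1..m}"
    if "k \<in> cover_ideal K n (obj f {}) (kernel_at f) {1..Suc m}"
    using cover_ideal_to_pairs[of "{1..m}" "kernel_at f" "Suc m" k, OF N kernel_at_eq] that unfolding ideal S by blast
  show "proj1 z \<ominus>\<^bsub>obj f {}\<^esub> proj0 z \<in> cover_ideal K n (obj f {}) (kernel_at f) {1..Suc m}"
    if "z \<in> cover_ideal K n (obj (kernel_pair (Suc m) f) {}) (kernel_at (kernel_pair (Suc m) f)) {1..m}"
    using cover_ideal_of_pairs[of "{1..m}" "kernel_at f" "Suc m" z, OF N kernel_at_eq] that unfolding ideal S by blast
qed

section \<open>Higher centrality\<close>

text \<open>For \<open>m = 0\<close> nothing has to be served, and all tuples are admitted on both sides. In the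
  inductive step the two halves of the comparison are the two inclusions, the second one being applied
  to pairs \<open>(0, k)\<close>.\<close>

lemma higher_L_eq_cover_ideal:
  assumes "is_fold_arrow K n m f"
  shows "higher_L K n m f = cover_ideal K n (obj f {}) (kernel_at f) {1..m}"
  using assms
proof (induction m arbitrary: f)
  case 0
  have "list_all2 (\<in>) ls (replicate n (carrier (obj f {}))) \<longleftrightarrow> set ls \<subseteq> carrier (obj f {})"
    if "length ls = n" for ls
    using that by (fastforce simp: list_all2_conv_all_nth in_set_conv_nth)
  then have "\<sigma> permutes {..<n} \<and> length ls = n \<and> list_all2 (\<in>) ls (replicate n (carrier (obj f {}))) \<longleftrightarrow>
      \<sigma> permutes {..<n} \<and> length ls = n \<and> set ls \<subseteq> carrier (obj f {}) \<and>
        (\<forall>i\<in>{1..0}. \<exists>p<n. ls ! p \<in> kernel_at f i)" for \<sigma> ls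
    by auto
  then show ?case
    by (simp only: higher_L.simps rel_commutator_def cover_ideal_def cover_defects_def)
next
  case (Suc m)
  interpret leibniz_algebra K n "obj f {}"
    using Suc.prems by (simp add: is_fold_arrow_def)
  have IH: "higher_L K n m (kernel_pair (Suc m) f)
      = cover_ideal K n (obj (kernel_pair (Suc m) f) {}) (kernel_at (kernel_pair (Suc m) f)) {1..m}"
    by (rule Suc.IH[OF kernel_pair_fold_arrow[OF Suc.prems]])
  note pairs = cover_ideal_kernel_pair[OF Suc.prems]
  have "cover_ideal K n (obj f {}) (kernel_at f) {1..Suc m} \<subseteq> carrier (obj f {})"
    by (rule ideal_props(1)[OF ideal_cover_ideal])
  moreover have "k \<in> cover_ideal K n (obj f {}) (kernel_at f) {1..Suc m}"
    if "k \<in> carrier (obj f {})" "Couple \<zero>\<^bsub>obj f {}\<^esub> k \<in> higher_L K n m (kernel_pair (Suc m) f)" for k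
    using pairs(2)[of "Couple \<zero>\<^bsub>obj f {}\<^esub> k"] that by (simp add: IH minus_zero_right)
  ultimately show ?case using pairs(1) unfolding higher_L.simps IH by blast
qed

text \<open>If the projections agree on \<open>L\<^sub>m\<^sub>-\<^sub>1[R]\<close>, they agree on \<open>(0, k)\<close> for all \<open>k\<close> in the ideal of \<open>f\<close>.
  Conversely \<open>y - x\<close> is in that ideal for every \<open>(x, y) \<in> L\<^sub>m\<^sub>-\<^sub>1[R]\<close>.\<close>

lemma lie_central_iff_cover_ideal_zero:
  assumes "is_fold_arrow K n m f" "m \<ge> 1"
  shows "lie_central K n m f \<longleftrightarrow> cover_ideal K n (obj f {}) (kernel_at f) {1..m} = {\<zero>\<^bsub>obj f {}\<^esub>}"
proof -
  obtain m' where m: "m = Suc m'" using assms(2) by (cases m) auto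
  note f = assms(1)[unfolded m]
  interpret leibniz_algebra K n "obj f {}"
    using f by (simp add: is_fold_arrow_def)
  let ?J = "cover_ideal K n (obj f {}) (kernel_at f) {1..Suc m'}"
  let ?R = "kernel_pair (Suc m') f"
  have L: "higher_L K n m' ?R = cover_ideal K n (obj ?R {}) (kernel_at ?R) {1..m'}"
    by (rule higher_L_eq_cover_ideal[OF kernel_pair_fold_arrow[OF f]])
  interpret R: leibniz_algebra K n "obj ?R {}"
    using kernel_pair_fold_arrow[OF f] by (simp add: is_fold_arrow_def)
  note pairs = cover_ideal_kernel_pair[OF f, folded L]
  have "\<zero>\<^bsub>obj f {}\<^esub> \<in> ?J" by (rule ideal_props(2)[OF ideal_cover_ideal])
  moreover have "proj0 z = proj1 z" if "?J = {\<zero>\<^bsub>obj f {}\<^esub>}" "z \<in> higher_L K n m' ?R" for z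
  proof -
    have "z \<in> carrier (obj ?R {})"
      using that(2) R.ideal_props(1)[OF R.ideal_cover_ideal] unfolding L by blast
    then have c: "proj0 z \<in> carrier (obj f {})" "proj1 z \<in> carrier (obj f {})"
      unfolding obj_kernel_pair by (rule pair_carrierD)+
    have "proj1 z \<ominus>\<^bsub>obj f {}\<^esub> proj0 z = \<zero>\<^bsub>obj f {}\<^esub>" using pairs(2)[OF that(2)] that(1) by blast
    then have "proj1 z = \<zero>\<^bsub>obj f {}\<^esub> \<oplus>\<^bsub>obj f {}\<^esub> proj0 z"
      using c by (metis M.add.m_assoc M.l_neg M.r_zero M.add.inv_closed a_minus_def)
    then show ?thesis using c by simp
  qed
  moreover have "k = \<zero>\<^bsub>obj f {}\<^esub>"
    if "\<forall>z\<in>higher_L K n m' ?R. proj0 z = proj1 z" "k \<in> ?J" for k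
    using pairs(1)[OF that(2)] that(1) by fastforce
  ultimately show ?thesis unfolding lie_central_def m by auto
qed

text \<open>Each summand contains the skew defects of the tuples adapted to its cover, and every admissible
  tuple is adapted to some cover, namely \<open>I\<^sub>p = {i \<in> S. l\<^sub>p \<in> N\<^sub>i}\<close>.\<close>

lemma (in leibniz_algebra) cover_ideal_zero_iff_family_sum:
  assumes "finite S"
  shows "cover_ideal K n L N S = {\<zero>\<^bsub>L\<^esub>} \<longleftrightarrow>
    family_sum L {Is. length Is = n \<and> \<Union> (set Is) = S}
      (\<lambda>Is. rel_commutator K n L (map (\<lambda>I. carrier L \<inter> (\<Inter>i\<in>I. N i)) Is)) = {\<zero>\<^bsub>L\<^esub>}"
    (is "?J = _ \<longleftrightarrow> family_sum L ?T ?C = _")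
proof -
  have "?T \<subseteq> {Is. set Is \<subseteq> Pow S \<and> length Is = n}" by auto
  then have fin: "finite ?T"
    using finite_lists_length_eq[of "Pow S" n] assms finite_subset by auto
  have C_ideal: "leibniz_ideal K n L (?C Is)" for Is
  proof -
    have "set ls \<subseteq> carrier L"
      if "list_all2 (\<in>) ls (map (\<lambda>I. carrier L \<inter> (\<Inter>i\<in>I. N i)) Is)" for ls
      using that by (auto simp: list_all2_conv_all_nth in_set_conv_nth)
    then show ?thesis
      unfolding rel_commutator_def by (intro ideal_hull) (auto intro!: skew_defect_closed)
  qed
  have "family_sum L ?T ?C = {\<zero>\<^bsub>L\<^esub>}" if J: "?J = {\<zero>\<^bsub>L\<^esub>}"
  proof -
    have C: "?C Is \<subseteq> ?J" if Is: "Is \<in> ?T" for Is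
      unfolding rel_commutator_def
    proof (rule hull_minimal, rule subsetI, elim CollectE exE conjE)
      fix g \<sigma> ls assume g: "g = skew_defect L \<sigma> ls" and ls: "\<sigma> permutes {..<n}" "length ls = n"
        "list_all2 (\<in>) ls (map (\<lambda>I. carrier L \<inter> (\<Inter>i\<in>I. N i)) Is)"
      then have entry: "ls ! p \<in> carrier L \<inter> (\<Inter>i\<in>Is ! p. N i)" if "p < n" for p
        using list_all2_nthD[OF ls(3), of p] that Is ls(2) by simp
      have set: "set ls \<subseteq> carrier L" using entry ls(2) by (auto simp: in_set_conv_nth)
      have "\<exists>p<n. ls ! p \<in> N i" if "i \<in> S" for i
      proof -
        have "i \<in> \<Union> (set Is)" using that Is by simp
        then obtain p where "p < n" "i \<in> Is ! p" using Is by (auto simp: in_set_conv_nth)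
        then show ?thesis using entry by blast
      qed
      then show "g \<in> ?J"
        unfolding g by (rule cover_idealI[OF ls(1,2) set])
    qed (rule ideal_cover_ideal)
    have zero: "(\<Oplus>\<^bsub>L\<^esub>t\<in>?T. x t) = \<zero>\<^bsub>L\<^esub>" if "x \<in> (\<Pi> t\<in>?T. ?C t)" for x
    proof -
      have "x t = \<zero>\<^bsub>L\<^esub>" if "t \<in> ?T" for t
        using C[OF that] J Pi_mem[OF \<open>x \<in> (\<Pi> t\<in>?T. ?C t)\<close> that] by blast
      then show ?thesis by (rule M.add.finprod_one_eqI)
    qed
    have zero_family: "(\<lambda>_. \<zero>\<^bsub>L\<^esub>) \<in> (\<Pi> t\<in>?T. ?C t)"
      by (rule Pi_I) (rule ideal_props(2)[OF C_ideal])
    show ?thesis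
    proof (intro equalityI subsetI)
      fix y assume "y \<in> family_sum L ?T ?C"
      then obtain x where "y = (\<Oplus>\<^bsub>L\<^esub>t\<in>?T. x t)" "x \<in> (\<Pi> t\<in>?T. ?C t)"
        unfolding family_sum_def by (elim CollectE exE conjE)
      then show "y \<in> {\<zero>\<^bsub>L\<^esub>}" by (simp only: zero singleton_iff)
    next
      fix y assume "y \<in> {\<zero>\<^bsub>L\<^esub>}"
      then have "y = (\<Oplus>\<^bsub>L\<^esub>t\<in>?T. \<zero>\<^bsub>L\<^esub>)" using zero[OF zero_family] by simp
      then show "y \<in> family_sum L ?T ?C"
        unfolding family_sum_def using zero_family by (intro CollectI exI conjI)
    qed
  qed
  moreover have "?J = {\<zero>\<^bsub>L\<^esub>}" if sum: "family_sum L ?T ?C = {\<zero>\<^bsub>L\<^esub>}"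
  proof -
    have "?J \<subseteq> {\<zero>\<^bsub>L\<^esub>}"
    proof (rule cover_ideal_subset[OF ideal_zero])
      fix \<sigma> ls assume ls: "\<sigma> permutes {..<n}" "length ls = n" "set ls \<subseteq> carrier L"
        and cover: "\<forall>i\<in>S. \<exists>p<n. ls ! p \<in> N i"
      define Is where "Is = map (\<lambda>x. {i \<in> S. x \<in> N i}) ls"
      have Is: "Is \<in> ?T" using ls cover by (fastforce simp: Is_def)
      have "skew_defect L \<sigma> ls \<in> ?C Is"
        unfolding rel_commutator_def
      proof (rule hull_inc, rule CollectI, intro exI conjI)
        show "list_all2 (\<in>) ls (map (\<lambda>I. carrier L \<inter> (\<Inter>i\<in>I. N i)) Is)"
          using ls nth_carrier by (auto simp: Is_def list_all2_conv_all_nth)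
      qed (use ls in simp_all)
      note g = this
      \<comment> \<open>The defect is itself an element of the sum, as the only nonzero term of a family.\<close>
      define x where "x = (\<lambda>_. \<zero>\<^bsub>L\<^esub>)(Is := skew_defect L \<sigma> ls)"
      have x: "x \<in> (\<Pi> t\<in>?T. ?C t)"
      proof (rule Pi_I)
        show "x t \<in> ?C t" for t
          using g ideal_props(2)[OF C_ideal[of t]] by (cases "t = Is") (simp_all add: x_def)
      qed
      have "(\<Oplus>\<^bsub>L\<^esub>t\<in>?T. x t) \<in> family_sum L ?T ?C"
        unfolding family_sum_def by (intro CollectI exI conjI) (rule refl, rule x)
      then have "(\<Oplus>\<^bsub>L\<^esub>t\<in>?T. x t) = \<zero>\<^bsub>L\<^esub>" unfolding sum by (rule singletonD)
      moreover have "(\<Oplus>\<^bsub>L\<^esub>t\<in>?T. x t) = skew_defect L \<sigma> ls"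
      proof -
        have "(\<Oplus>\<^bsub>L\<^esub>t\<in>?T. x t) = (\<Oplus>\<^bsub>L\<^esub>t\<in>?T. if Is = t then skew_defect L \<sigma> ls else \<zero>\<^bsub>L\<^esub>)"
          by (rule M.finsum_cong') (use skew_defect_closed[OF ls] in \<open>auto simp: x_def\<close>)
        also have "\<dots> = skew_defect L \<sigma> ls"
          using M.finsum_singleton[OF Is fin, of "\<lambda>_. skew_defect L \<sigma> ls"] skew_defect_closed[OF ls] by simp
        finally show ?thesis .
      qed
      ultimately show "skew_defect L \<sigma> ls \<in> {\<zero>\<^bsub>L\<^esub>}" by simp
    qed
    then show ?thesis using ideal_props(2)[OF ideal_cover_ideal[of N S]] by blast
  qed
  ultimately show ?thesis by blast
qed

theorem proposition5p6:
  fixes K :: "('k, 'c) ring_scheme"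
    and n m :: nat
    and f :: "('k, 'a nest) fold_arrow"
  assumes "n \<ge> 2"
    and "field K"
    and char_not_2: "\<one>\<^bsub>K\<^esub> \<oplus>\<^bsub>K\<^esub> \<one>\<^bsub>K\<^esub> \<noteq> \<zero>\<^bsub>K\<^esub>"
    and "m \<ge> 1"
    and "is_fold_extension K n m f"
  shows "lie_central K n m f \<longleftrightarrow>
    family_sum (obj f {}) {Is. length Is = n \<and> \<Union> (set Is) = {1..m}}
      (\<lambda>Is. rel_commutator K n (obj f {}) (map (kernel_meet f) Is)) = {\<zero>\<^bsub>obj f {}\<^esub>}"
proof -
  have f: "is_fold_arrow K n m f" using assms(5) unfolding is_fold_extension_def by blast
  interpret leibniz_algebra K n "obj f {}" using f by (simp add: is_fold_arrow_def)
  have meet: "kernel_meet f = (\<lambda>I. carrier (obj f {}) \<inter> (\<Inter>i\<in>I. kernel_at f i))"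
    by (rule ext) (simp add: kernel_meet_def)
  show ?thesis
    unfolding lie_central_iff_cover_ideal_zero[OF f \<open>m \<ge> 1\<close>] meet
    by (rule cover_ideal_zero_iff_family_sum) simp
qed

end
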